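(* Let $(f,g)$ belong to one of the three families (F1), (F2), (F3) described in the context, and write $f=f_1+f_2+f_3$, $g=g_1+g_2+g_3$ for the decompositions into homogeneous components. If $f_1g_1\neq 0$ and $g_2=f_2$, then $$1\leq I_0(f,g)<7.$$
   Context: All coefficients $C_{hk}^{rs}$ below are complex numbers. The families are local representations $f\,dy+g\,dz$ (in the chart $x=1$) at the singular point $[1:0:0]$ of degree-2 foliation $1$-forms $\omega_\lambda=A\,dx+B\,dy+C\,dz$ on $\mathbb{CP}^2$ (with $xA+yB+zC=0$, $f=B(1,y,z)$, $g=C(1,y,z)$): (F1) partition $\lambda(1)=(3^2,1)$ of $7$, leading terms $LT=\{y^3,-z^3,yz^2\}$: $f=-C_{10}^{03}y-y^{2}-C_{01}^{03}z-C_{11}^{03}yz+C_{11}^{12}z^{2}-z^{3}$, $g=-C_{10}^{12}y-C_{20}^{12}y^{2}-C_{01}^{12}z-C_{11}^{12}yz+yz^{2}$. (F2) partition $\lambda(2)=(3,2,1^2)$ of $7$, leading terms $LT_{21}=\{y^3,-yz^2,y^2z\}$, with $C_{02}^{21}\neq0$: $f=-C_{10}^{12}y-y^{2}-C_{01}^{12}z+C_{20}^{21}yz+C_{11}^{21}z^{2}-yz^{2}$, $g=-C_{10}^{21}y-C_{20}^{21}y^{2}-C_{01}^{21}z-C_{11}^{21}yz+y^{2}z-C_{02}^{21}z^{2}$. (F3) partition $\lambda(2)=(3,2,1^2)$ of $7$, leading terms $LT_{22}=\{yz^2,-y^2z,y^3\}$, with $C_{02}^{30}\neq0$: $f=-C_{10}^{21}y-C_{01}^{21}z+C_{20}^{30}yz-y^{2}z+(C_{11}^{30}-1)z^{2}$,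 $g=-C_{10}^{30}y-C_{20}^{30}y^{2}+y^{3}-C_{01}^{30}z-C_{11}^{30}yz-C_{02}^{30}z^{2}$. $f_i,g_i\in\mathbb{C}[y,z]$ denote the homogeneous components of degree $i$. $I_0(f,g)=\dim_{\mathbb{C}}\mathcal{O}_{\mathbb{C}^2,(0,0)}/\langle f,g\rangle$ is the intersection index of $f$ and $g$ at the origin ($\infty$ if the dimension is infinite). *)

theory Defs
  imports "HOL-Analysis.Analysis" "HOL-Computational_Algebra.Polynomial"
    "HOL-Library.Extended_Nat" "HOL-Algebra.Embedded_Algebras"
begin

section \<open>The local ring of holomorphic germs at the origin of the complex plane\<close>

text \<open>
  Holomorphic near the origin: (Frechet-)differentiable at every point of a neighbourhood,
  with a complex-linear derivative. Functions are total; their values away from the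
  neighbourhood are irrelevant and disappear in the ring of germs.
\<close>

definition holomorphic_near_0 :: "(complex \<times> complex \<Rightarrow> complex) \<Rightarrow> bool" where
  "holomorphic_near_0 F \<longleftrightarrow>
     (\<exists>U. open U \<and> (0, 0) \<in> U \<and>
       (\<forall>p\<in>U. \<exists>a b. (F has_derivative (\<lambda>(u, v). a * u + b * v)) (at p)))"

definition hol_ring :: "(complex \<times> complex \<Rightarrow> complex) ring" where
  "hol_ring =
     \<lparr>carrier = {F. holomorphic_near_0 F},
      mult = (\<lambda>F G p. F p * G p), one = (\<lambda>p. 1),
      zero = (\<lambda>p. 0), add = (\<lambda>F G p. F p + G p)\<rparr>"

definition null_germs :: "(complex \<times> complex \<Rightarrow> complex) set" where
  "null_germs = {F. holomorphic_near_0 F \<and> eventually (\<lambda>p. F p = 0) (nhds (0, 0))}"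

text \<open>
  Two functions have the same germ iff they agree near the origin, i.e. iff their
  difference lies in \<open>null_germs\<close>; so germs are cosets of this ideal.
\<close>

definition germ_ring :: "(complex \<times> complex \<Rightarrow> complex) set ring" where
  "germ_ring = hol_ring Quot null_germs"

definition germ :: "(complex \<times> complex \<Rightarrow> complex) \<Rightarrow> (complex \<times> complex \<Rightarrow> complex) set" where
  "germ F = null_germs +>\<^bsub>hol_ring\<^esub> F"

lemma holomorphic_near_0_const: "holomorphic_near_0 (\<lambda>p. c)"
proof -
  have "((\<lambda>p::complex \<times> complex. c) has_derivative (\<lambda>(u, v). 0 * u + 0 * v)) (at p)" for p
    by (simp add: case_prod_unfold)
  then show ?thesis
    unfolding holomorphic_near_0_def by (intro exI[of _ UNIV]) blast
qed

lemma holomorphic_near_0_add: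
  assumes "holomorphic_near_0 F" "holomorphic_near_0 G"
  shows "holomorphic_near_0 (\<lambda>p. F p + G p)"
proof -
  from assms obtain U V where U: "open U" "(0,0) \<in> U" 
      "\<And>p. p \<in> U \<Longrightarrow> \<exists>a b. (F has_derivative (\<lambda>(u, v). a * u + b * v)) (at p)"
    and V: "open V" "(0,0) \<in> V"
      "\<And>p. p \<in> V \<Longrightarrow> \<exists>a b. (G has_derivative (\<lambda>(u, v). a * u + b * v)) (at p)"
    unfolding holomorphic_near_0_def by blast
  have "\<exists>a b. ((\<lambda>p. F p + G p) has_derivative (\<lambda>(u, v). a * u + b * v)) (at p)"
    if p: "p \<in> U \<inter> V" for p
  proof -
    obtain a b c d where "(F has_derivative (\<lambda>(u, v). a * u + b * v)) (at p)"
      "(G has_derivative (\<lambda>(u, v). c * u + d * v)) (at p)" using U(3) V(3) p by blast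
    from has_derivative_add[OF this]
    have "((\<lambda>p. F p + G p) has_derivative (\<lambda>(u, v). (a + c) * u + (b + d) * v)) (at p)"
      by (simp add: case_prod_unfold algebra_simps)
    then show ?thesis by blast
  qed
  then show ?thesis unfolding holomorphic_near_0_def
    using U V by (intro exI[of _ "U \<inter> V"]) (auto intro: open_Int)
qed

lemma holomorphic_near_0_mult:
  assumes "holomorphic_near_0 F" "holomorphic_near_0 G"
  shows "holomorphic_near_0 (\<lambda>p. F p * G p)"
proof -
  from assms obtain U V where U: "open U" "(0,0) \<in> U" 
      "\<And>p. p \<in> U \<Longrightarrow> \<exists>a b. (F has_derivative (\<lambda>(u, v). a * u + b * v)) (at p)"
    and V: "open V" "(0,0) \<in> V"
      "\<And>p. p \<in> V \<Longrightarrow> \<exists>a b. (G has_derivative (\<lambda>(u, v). a * u + b * v)) (at p)"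
    unfolding holomorphic_near_0_def by blast
  have "\<exists>a b. ((\<lambda>p. F p * G p) has_derivative (\<lambda>(u, v). a * u + b * v)) (at p)"
    if p: "p \<in> U \<inter> V" for p
  proof -
    obtain a b c d where "(F has_derivative (\<lambda>(u, v). a * u + b * v)) (at p)"
      "(G has_derivative (\<lambda>(u, v). c * u + d * v)) (at p)" using U(3) V(3) p by blast
    from has_derivative_mult[OF this]
    have "((\<lambda>p. F p * G p) has_derivative
        (\<lambda>(u, v). (F p * c + a * G p) * u + (F p * d + b * G p) * v)) (at p)"
      by (simp add: case_prod_unfold algebra_simps)
    then show ?thesis by blast
  qed
  then show ?thesis unfolding holomorphic_near_0_def
    using U V by (intro exI[of _ "U \<inter> V"]) (auto intro: open_Int)
qed

lemma cring_hol_ring: "cring hol_ring"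
proof (rule cringI)
  show "abelian_group hol_ring"
  proof (rule abelian_groupI)
    fix F assume "F \<in> carrier hol_ring"
    then have "(\<lambda>p. - 1 * F p) \<in> carrier hol_ring"
      using holomorphic_near_0_mult[OF holomorphic_near_0_const[of "-1"]]
      by (simp add: hol_ring_def)
    then show "\<exists>G\<in>carrier hol_ring. G \<oplus>\<^bsub>hol_ring\<^esub> F = \<zero>\<^bsub>hol_ring\<^esub>"
      by (rule bexI[rotated]) (simp add: hol_ring_def)
  qed (auto simp: hol_ring_def fun_eq_iff algebra_simps
        intro: holomorphic_near_0_add holomorphic_near_0_const)
  show "comm_monoid hol_ring"
    by (rule comm_monoidI) (auto simp: hol_ring_def fun_eq_iff algebra_simps
        intro: holomorphic_near_0_mult holomorphic_near_0_const)
qed (auto simp: hol_ring_def fun_eq_iff algebra_simps)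

lemma ideal_null_germs: "ideal null_germs hol_ring"
proof (rule idealI)
  interpret cring hol_ring by (rule cring_hol_ring)
  show "ring hol_ring" by (rule ring_axioms)
  have inv: "\<ominus>\<^bsub>hol_ring\<^esub> F = (\<lambda>p. - F p)" if "holomorphic_near_0 F" for F
  proof (rule minus_equality)
    show "(\<lambda>p. - F p) \<oplus>\<^bsub>hol_ring\<^esub> F = \<zero>\<^bsub>hol_ring\<^esub>" by (simp add: hol_ring_def)
    show "F \<in> carrier hol_ring" using that by (simp add: hol_ring_def)
    show "(\<lambda>p. - F p) \<in> carrier hol_ring"
      using holomorphic_near_0_mult[OF holomorphic_near_0_const[of "-1"] that]
      by (simp add: hol_ring_def)
  qed
  show "subgroup null_germs (add_monoid hol_ring)"
  proof (rule add.subgroupI)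
    show "null_germs \<subseteq> carrier hol_ring" by (auto simp: null_germs_def hol_ring_def)
    show "null_germs \<noteq> {}"
      using holomorphic_near_0_const[of 0] by (auto simp: null_germs_def)
  next
    fix F assume F: "F \<in> null_germs"
    then have "holomorphic_near_0 (\<lambda>p. - F p)"
      using holomorphic_near_0_mult[OF holomorphic_near_0_const[of "-1"], of F]
      by (simp add: null_germs_def)
    with F show "\<ominus>\<^bsub>hol_ring\<^esub> F \<in> null_germs" by (simp add: null_germs_def inv)
  next
    fix F G assume "F \<in> null_germs" "G \<in> null_germs"
    then show "F \<oplus>\<^bsub>hol_ring\<^esub> G \<in> null_germs"
      by (auto simp: null_germs_def hol_ring_def intro: holomorphic_near_0_add
          elim: eventually_elim2)
  qed
qed (auto simp: null_germs_def hol_ring_def intro: holomorphic_near_0_mult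
      elim: eventually_mono)

lemma cring_germ_ring: "cring germ_ring"
  unfolding germ_ring_def by (rule ideal.quotient_is_cring[OF ideal_null_germs cring_hol_ring])

lemma germ_eq_iff:
  assumes "holomorphic_near_0 F" "holomorphic_near_0 G"
  shows "germ F = germ G \<longleftrightarrow> eventually (\<lambda>p. F p = G p) (nhds (0, 0))"
proof -
  interpret cring hol_ring by (rule cring_hol_ring)
  interpret ideal null_germs hol_ring by (rule ideal_null_germs)
  have hG: "holomorphic_near_0 (\<lambda>p. - G p)"
    using holomorphic_near_0_mult[OF holomorphic_near_0_const[of "-1"] assms(2)] by simp
  have inv: "\<ominus>\<^bsub>hol_ring\<^esub> G = (\<lambda>p. - G p)"
    by (rule minus_equality) (use hG assms(2) in \<open>simp_all add: hol_ring_def\<close>)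
  have c: "F \<in> carrier hol_ring" "G \<in> carrier hol_ring"
    using assms by (auto simp: hol_ring_def)
  have "germ F = germ G \<longleftrightarrow> F \<ominus>\<^bsub>hol_ring\<^esub> G \<in> null_germs"
    unfolding germ_def using quotient_eq_iff_same_a_r_cos[OF ideal_null_germs c] by simp
  also have "F \<ominus>\<^bsub>hol_ring\<^esub> G = (\<lambda>p. F p - G p)"
    unfolding a_minus_def inv by (simp add: hol_ring_def)
  also have "\<dots> \<in> null_germs \<longleftrightarrow> eventually (\<lambda>p. F p = G p) (nhds (0, 0))"
    using holomorphic_near_0_add[OF assms(1) hG] by (simp add: null_germs_def)
  finally show ?thesis .
qed


section \<open>The intersection index at the origin\<close>

text \<open>
  The dimension of the quotient algebra over the complex numbers, which sit in it as the
  classes of the constant germs.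
\<close>

definition intersection_index ::
    "(complex \<times> complex \<Rightarrow> complex) \<Rightarrow> (complex \<times> complex \<Rightarrow> complex) \<Rightarrow> enat" where
  "intersection_index F G =
     (let I = genideal germ_ring {germ F, germ G};
          Q = germ_ring Quot I;
          K = range (\<lambda>c. I +>\<^bsub>germ_ring\<^esub> germ (\<lambda>p. c))
      in if ring.finite_dimension Q K (carrier Q)
         then enat (ring.dim Q K (carrier Q)) else \<infinity>)"


section \<open>Polynomials in y and z\<close>

text \<open>
  The polynomial ring in \<open>y\<close>, \<open>z\<close> is represented as \<open>complex poly poly\<close>, the outer
  variable being \<open>z\<close>: the coefficient of \<open>y\<^sup>i z\<^sup>j\<close> in \<open>p\<close> is \<open>coeff (coeff p j) i\<close>.
\<close>

abbreviation cst :: "complex \<Rightarrow> complex poly poly" where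
  "cst c \<equiv> [:[:c:]:]"

abbreviation Y :: "complex poly poly" where
  "Y \<equiv> [:[:0, 1:]:]"

abbreviation Z :: "complex poly poly" where
  "Z \<equiv> [:0, 1:]"

definition eval2 :: "complex poly poly \<Rightarrow> complex \<times> complex \<Rightarrow> complex" where
  "eval2 p = (\<lambda>(y, z). poly (poly p [:z:]) y)"

lemma eval2_simps:
  "eval2 (cst c) (y, z) = c" "eval2 Y (y, z) = y" "eval2 Z (y, z) = z"
  "eval2 (p + q) (y, z) = eval2 p (y, z) + eval2 q (y, z)"
  "eval2 (p - q) (y, z) = eval2 p (y, z) - eval2 q (y, z)"
  "eval2 (p * q) (y, z) = eval2 p (y, z) * eval2 q (y, z)"
  by (simp_all add: eval2_def)

lemma holomorphic_near_0_eval2: "holomorphic_near_0 (eval2 p)"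
proof -
  have yz: "holomorphic_near_0 (\<lambda>p. fst p)" "holomorphic_near_0 (\<lambda>p. snd p)"
  proof -
    have "((\<lambda>p::complex \<times> complex. fst p) has_derivative (\<lambda>(u, v). 1 * u + 0 * v)) (at p)"
      and "((\<lambda>p::complex \<times> complex. snd p) has_derivative (\<lambda>(u, v). 0 * u + 1 * v)) (at p)" for p
      by (auto simp: case_prod_unfold intro!: derivative_eq_intros)
    then show "holomorphic_near_0 (\<lambda>p. fst p)" "holomorphic_near_0 (\<lambda>p. snd p)"
      unfolding holomorphic_near_0_def by (intro exI[of _ UNIV]; blast)+
  qed
  have y: "holomorphic_near_0 (\<lambda>p. poly a (fst p))" for a
    by (induction a) (auto intro!: holomorphic_near_0_add holomorphic_near_0_mult
        holomorphic_near_0_const yz)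
  show ?thesis
  proof (induction p)
    case 0
    then show ?case by (simp add: eval2_def case_prod_unfold holomorphic_near_0_const)
  next
    case (pCons a p)
    have "eval2 (pCons a p) = (\<lambda>q. poly a (fst q) + snd q * eval2 p q)"
      by (auto simp: eval2_def fun_eq_iff)
    then show ?case
      by (simp only:) (intro holomorphic_near_0_add holomorphic_near_0_mult y yz pCons)
  qed
qed

definition hom_comp :: "nat \<Rightarrow> complex poly poly \<Rightarrow> complex poly poly" where
  "hom_comp d p =
     (\<Sum>i\<le>d. cst (Polynomial.coeff (Polynomial.coeff p (d - i)) i) * Y ^ i * Z ^ (d - i))"


section \<open>The three families\<close>

text \<open>\<open>C h k r s\<close> stands for the coefficient with lower index \<open>hk\<close> and upper index \<open>rs\<close>.\<close>

type_synonym coeffs = "nat \<Rightarrow> nat \<Rightarrow> nat \<Rightarrow> nat \<Rightarrow> complex"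

definition f1 :: "coeffs \<Rightarrow> complex poly poly" where
  "f1 C = - cst (C 1 0 0 3) * Y - Y^2 - cst (C 0 1 0 3) * Z - cst (C 1 1 0 3) * Y * Z
          + cst (C 1 1 1 2) * Z^2 - Z^3"

definition g1 :: "coeffs \<Rightarrow> complex poly poly" where
  "g1 C = - cst (C 1 0 1 2) * Y - cst (C 2 0 1 2) * Y^2 - cst (C 0 1 1 2) * Z
          - cst (C 1 1 1 2) * Y * Z + Y * Z^2"

definition f2 :: "coeffs \<Rightarrow> complex poly poly" where
  "f2 C = - cst (C 1 0 1 2) * Y - Y^2 - cst (C 0 1 1 2) * Z + cst (C 2 0 2 1) * Y * Z
          + cst (C 1 1 2 1) * Z^2 - Y * Z^2"

definition g2 :: "coeffs \<Rightarrow> complex poly poly" where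
  "g2 C = - cst (C 1 0 2 1) * Y - cst (C 2 0 2 1) * Y^2 - cst (C 0 1 2 1) * Z
          - cst (C 1 1 2 1) * Y * Z + Y^2 * Z - cst (C 0 2 2 1) * Z^2"

definition f3 :: "coeffs \<Rightarrow> complex poly poly" where
  "f3 C = - cst (C 1 0 2 1) * Y - cst (C 0 1 2 1) * Z + cst (C 2 0 3 0) * Y * Z - Y^2 * Z
          + cst (C 1 1 3 0 - 1) * Z^2"

definition g3 :: "coeffs \<Rightarrow> complex poly poly" where
  "g3 C = - cst (C 1 0 3 0) * Y - cst (C 2 0 3 0) * Y^2 + Y^3 - cst (C 0 1 3 0) * Z
          - cst (C 1 1 3 0) * Y * Z - cst (C 0 2 3 0) * Z^2"

definition F1 :: "(complex poly poly \<times> complex poly poly) set" where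
  "F1 = {(f1 C, g1 C) | C. True}"

definition F2 :: "(complex poly poly \<times> complex poly poly) set" where
  "F2 = {(f2 C, g2 C) | C. C 0 2 2 1 \<noteq> 0}"

definition F3 :: "(complex poly poly \<times> complex poly poly) set" where
  "F3 = {(f3 C, g3 C) | C. C 0 2 3 0 \<noteq> 0}"

lemma hom_comp_decomposition:
  assumes "(f, g) \<in> F1 \<union> F2 \<union> F3"
  shows "f = hom_comp 1 f + hom_comp 2 f + hom_comp 3 f"
    and "g = hom_comp 1 g + hom_comp 2 g + hom_comp 3 g"
  using assms
  unfolding F1_def F2_def F3_def f1_def g1_def f2_def g2_def f3_def g3_def hom_comp_def
  by (auto simp: numeral_eq_Suc one_pCons)

end

theory Submission
  imports Defs "HOL-Complex_Analysis.Cauchy_Integral_Formula"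
begin

text \<open>
  The hypothesis \<open>g\<^sub>2 = f\<^sub>2\<close> leaves only the linear coefficients of \<open>f\<close> and \<open>g\<close> free. If \<open>f\<^sub>1\<close> and
  \<open>g\<^sub>1\<close> are independent, the curves are transversal and the index is 1. Otherwise \<open>g\<^sub>1 = t f\<^sub>1\<close>
  with \<open>t \<noteq> 0\<close>; since \<open>f = 0\<close> is smooth, one coordinate is a multiple of the other one, \<open>v\<close>,
  modulo \<open>f\<close>, and \<open>g - t f\<close> becomes a unit times \<open>v\<^sup>n\<close>, where \<open>n \<le> 5\<close> is its order of vanishing
  along that curve. So \<open>1, v, \<dots>, v\<^sup>n\<^sup>-\<^sup>1\<close> span the local algebra, by Taylor expansion of germs in \<open>v\<close>
  modulo \<open>(f, g)\<close>. This only uses that a germ vanishing at the origin lies in the ideal \<open>(y, z)\<close>,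
  which follows from the Cauchy integral formula in one variable.
\<close>

section \<open>Division of holomorphic germs by a coordinate\<close>

text \<open>By the chain rule the derivative stays complex linear. The instances needed are the swap
  of the two coordinates and the restriction of a germ to an axis.\<close>

lemma holomorphic_near_0_compose_linear:
  assumes F: "holomorphic_near_0 F"
  shows "holomorphic_near_0 (\<lambda>p. F (a * fst p + b * snd p, c * fst p + d * snd p))"
proof -
  let ?L = "\<lambda>p::complex \<times> complex. (a * fst p + b * snd p, c * fst p + d * snd p)"
  obtain U where U: "open U" "(0, 0) \<in> U"
    "\<And>p. p \<in> U \<Longrightarrow> \<exists>a b. (F has_derivative (\<lambda>(u, v). a * u + b * v)) (at p)"
    using F unfolding holomorphic_near_0_def by blast
  have L: "(?L has_derivative ?L) (at p)" for p
    by (auto intro!: derivative_eq_intros)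
  have "continuous_on UNIV ?L"
    by (intro continuous_intros)
  then have "open (?L -` U)"
    using U(1) by (auto simp: continuous_on_open_vimage)
  moreover have "\<exists>k l. ((\<lambda>p. F (?L p)) has_derivative (\<lambda>(u, v). k * u + l * v)) (at p)"
    if "p \<in> ?L -` U" for p
  proof -
    have "?L p \<in> U" using that by simp
    then obtain k l where kl: "(F has_derivative (\<lambda>(u, v). k * u + l * v)) (at (?L p))"
      using U(3) by blast
    have "((\<lambda>p. F (?L p)) has_derivative
        (\<lambda>(u, v). (k * a + l * c) * u + (k * b + l * d) * v)) (at p)"
      using has_derivative_compose[OF L kl] by (simp add: case_prod_unfold algebra_simps)
    then show ?thesis by blast
  qed
  ultimately show ?thesis
    using U(2) unfolding holomorphic_near_0_def by (intro exI[of _ "?L -` U"]) auto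
qed

text \<open>Restating Cauchy's formulas as integrals over a real interval makes the Leibniz rule for
  parameter integrals applicable. The circle has derivative \<open>2 * pi * \<i> * c t\<close>, so
  the constant cancels and a factor \<open>c t\<close> remains.\<close>

lemma Cauchy_integral_real_param:
  assumes g: "g holomorphic_on cball 0 r" and y: "norm y < r"
  defines "c \<equiv> \<lambda>t::real. of_real r * exp (2 * of_real pi * \<i> * of_real t)"
  shows "((\<lambda>t. g (c t) * c t / (c t - y)) has_integral g y) {0..1}"
    and "(g has_field_derivative integral {0..1} (\<lambda>t. g (c t) * c t / (c t - y)\<^sup>2)) (at y)"
proof -
  have c: "circlepath 0 r = c"
    by (simp add: c_def circlepath fun_eq_iff)
  have c': "vector_derivative c (at t) = 2 * of_real pi * \<i> * c t" for t
    using vector_derivative_circlepath[of 0 r t] by (simp add: c c_def)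
  have "((\<lambda>u. g u / (u - y)) has_contour_integral (2 * of_real pi * \<i> * g y)) (circlepath 0 r)"
    using Cauchy_integral_circlepath_simple[OF g, of y] y by simp
  then have "((\<lambda>t. g (c t) / (c t - y) * (2 * of_real pi * \<i> * c t))
      has_integral (2 * of_real pi * \<i> * g y)) {0..1}"
    by (simp only: has_contour_integral c c')
  from has_integral_mult_right[OF this, of "1 / (2 * of_real pi * \<i>)"]
  show "((\<lambda>t. g (c t) * c t / (c t - y)) has_integral g y) {0..1}"
    by (simp add: field_simps)
  have "continuous_on (cball 0 r) g" "g holomorphic_on ball 0 r"
    using g by (auto intro: holomorphic_on_imp_continuous_on holomorphic_on_subset)
  then have "(g has_field_derivative (1 / (2 * of_real pi * \<i>) *
      contour_integral (circlepath 0 r) (\<lambda>u. g u / (u - y)^2))) (at y)"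
    using y by (intro Cauchy_derivative_integral_circlepath) auto
  also have "1 / (2 * of_real pi * \<i>) * contour_integral (circlepath 0 r) (\<lambda>u. g u / (u - y)^2)
      = integral {0..1} (\<lambda>t. g (c t) * c t / (c t - y)\<^sup>2)"
    unfolding contour_integral_integral c c'
    by (subst integral_mult_right[symmetric]) (simp add: field_simps)
  finally show "(g has_field_derivative integral {0..1} (\<lambda>t. g (c t) * c t / (c t - y)\<^sup>2)) (at y)" .
qed

text \<open>Subtracting Cauchy's formulas in the first variable at y and at 0 exhibits (F(y,z) -
  F(0,z)) / y as a circle integral of F(u,z) / (u (u - y)). This integral also makes sense at y = 0
  and can be differentiated under the integral sign in both variables.\<close>

lemma holomorphic_near_0_divide_fst:
  assumes F: "holomorphic_near_0 F"
  obtains h where "holomorphic_near_0 h"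
    "\<forall>\<^sub>F p in nhds (0, 0). F p = F (0, snd p) + fst p * h p"
proof -
  obtain U where U: "open U" "(0, 0) \<in> U"
    "\<And>p. p \<in> U \<Longrightarrow> \<exists>a b. (F has_derivative (\<lambda>(u, v). a * u + b * v)) (at p)"
    using F unfolding holomorphic_near_0_def by blast
  obtain A B where AB: "open A" "open B" "(0, 0) \<in> A \<times> B" "A \<times> B \<subseteq> U"
    using open_prod_elim[OF U(1,2)] by metis
  obtain r1 r2 where r12: "r1 > 0" "cball 0 r1 \<subseteq> A" "r2 > 0" "cball 0 r2 \<subseteq> B"
    using AB(1,2,3) unfolding open_contains_cball by (metis mem_Sigma_iff)
  define r where "r = min r1 r2"
  \<comment> \<open>The contour bounds \<open>S\<close> while evaluation points stay in the open
    disc \<open>T\<close>, so the denominators never vanish.\<close>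
  define S where "S = cball (0::complex) r"
  define T where "T = ball (0::complex) r"
  have "S \<subseteq> A" "S \<subseteq> B"
    using r12 by (auto simp: S_def r_def)
  then have r: "r > 0" "S \<times> S \<subseteq> U" and TS: "T \<subseteq> S"
    using r12(1,3) AB(4) by (auto simp: r_def S_def T_def)
  define c :: "real \<Rightarrow> complex" where "c t = of_real r * exp (2 * of_real pi * \<i> * of_real t)" for t
  have norm_c: "norm (c t) = r" for t
    using r(1) by (simp add: c_def norm_mult)
  then have cS: "c t \<in> S" for t
    by (simp add: S_def)
  have cT: "c t \<notin> T" for t
    using norm_c[of t] by (simp add: T_def)
  have ne: "c t - y \<noteq> 0" if "y \<in> T" for t y
    using that cT[of t] by auto
  have cont_c [continuous_intros]: "continuous_on X (\<lambda>x. c (k x))"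
    if "continuous_on X k" for X :: "'x::topological_space set" and k
    unfolding c_def by (intro continuous_intros that)
  have contF: "continuous_on (S \<times> S) F"
    using r(2) U(3) by (intro continuous_at_imp_continuous_on) (blast dest: has_derivative_continuous)
  have cont_F [continuous_intros]: "continuous_on X (\<lambda>x. F (k x, l x))"
    if "continuous_on X k" "continuous_on X l" "\<And>x. x \<in> X \<Longrightarrow> k x \<in> S" "\<And>x. x \<in> X \<Longrightarrow> l x \<in> S"
    for X :: "'x::topological_space set" and k l
    using that by (intro continuous_on_compose2[OF contF] continuous_intros) auto
  have slice1: "(\<lambda>y. F (y, z)) holomorphic_on S" if "z \<in> S" for z
    unfolding holomorphic_on_def
  proof
    fix y assume "y \<in> S"
    then obtain a b where "(F has_derivative (\<lambda>(u, v). a * u + b * v)) (at (y, z))"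
      using U(3) r(2) \<open>z \<in> S\<close> by blast
    moreover have "((\<lambda>y. (y, z)) has_derivative (\<lambda>u. (u, 0))) (at y)"
      by (auto intro!: derivative_eq_intros)
    ultimately have "((\<lambda>y. F (y, z)) has_derivative (*) a) (at y)"
      using has_derivative_compose[of "\<lambda>y. (y, z)" "\<lambda>u. (u, 0)" y UNIV F "\<lambda>(u, v). a * u + b * v"] by simp
    then have "((\<lambda>y. F (y, z)) has_field_derivative a) (at y)"
      by (simp add: has_field_derivative_def)
    then show "(\<lambda>y. F (y, z)) field_differentiable (at y within S)"
      by (meson field_differentiable_at_within field_differentiable_def)
  qed
  have slice2: "((\<lambda>z. F (y, z)) has_field_derivative b) (at z)"
    if "(F has_derivative (\<lambda>(u, v). a * u + b * v)) (at (y, z))" for y z a b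
  proof -
    have "((\<lambda>z. (y, z)) has_derivative (\<lambda>u. (0, u))) (at z)"
      by (auto intro!: derivative_eq_intros)
    then have "((\<lambda>z. F (y, z)) has_derivative (*) b) (at z)"
      using has_derivative_compose[of "\<lambda>z. (y, z)" "\<lambda>u. (0, u)" z UNIV F "\<lambda>(u, v). a * u + b * v"] that by simp
    then show ?thesis by (simp add: has_field_derivative_def)
  qed
  have slice2_hol: "(\<lambda>z. F (y, z)) holomorphic_on S" if "y \<in> S" for y
    unfolding holomorphic_on_def
  proof
    fix z assume "z \<in> S"
    then show "(\<lambda>z. F (y, z)) field_differentiable (at z within S)"
      using U(3) r(2) \<open>y \<in> S\<close> slice2 
      by (meson SigmaI field_differentiable_at_within field_differentiable_def subsetD)
  qed
  \<comment> \<open>Holomorphy is only assumed as pointwise differentiability. Cauchy's integral for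
    the partial derivative in the second variable makes that derivative jointly continuous, as the
    Leibniz rule demands.\<close>
  define D where "D y z = integral (cbox 0 1) (\<lambda>t. F (y, c t) * c t / (c t - z)\<^sup>2)" for y z
  have contD: "continuous_on (S \<times> T) (\<lambda>p. D (fst p) (snd p))"
    unfolding D_def
    by (intro integral_continuous_on_param)
      (auto simp: case_prod_unfold cS cT intro!: continuous_intros)
  have cont_D [continuous_intros]: "continuous_on X (\<lambda>x. D (k x) (l x))"
    if "continuous_on X k" "continuous_on X l" "\<And>x. x \<in> X \<Longrightarrow> k x \<in> S" "\<And>x. x \<in> X \<Longrightarrow> l x \<in> T"
    for X :: "'x::topological_space set" and k l
    using that continuous_on_compose2[OF contD, of X "\<lambda>x. (k x, l x)"]
    by (auto intro!: continuous_intros)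
  have derivF: "\<exists>a. (F has_derivative (\<lambda>(u, v). a * u + D y z * v)) (at (y, z))"
    if "y \<in> S" "z \<in> T" for y z
  proof -
    have "((\<lambda>z. F (y, z)) has_field_derivative D y z) (at z)"
      using Cauchy_integral_real_param(2)[of "\<lambda>z. F (y, z)" r z] slice2_hol[OF that(1)] that(2)
      by (simp add: S_def T_def D_def c_def)
    moreover have "(y, z) \<in> U"
      using r(2) TS that by blast
    then obtain a b where ab: "(F has_derivative (\<lambda>(u, v). a * u + b * v)) (at (y, z))"
      using U(3) by blast
    ultimately have "b = D y z"
      using slice2 DERIV_unique by blast
    with ab show ?thesis by blast
  qed
  \<comment> \<open>On the circle, du is proportional to \<open>c t\<close> dt, which cancels the
    factor u of u (u - y).\<close>
  define h where "h p = integral (cbox 0 1) (\<lambda>t. F (c t, snd p) / (c t - fst p))" for p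
  \<comment> \<open>The Leibniz rule takes derivatives as bounded linear operators:
    \<open>T1 x\<close> and \<open>T2 x\<close> multiply the first, respectively second, component
    by \<open>x\<close>.\<close>
  define T1 where "T1 x = blinfun_mult_right x o\<^sub>L (fst_blinfun :: (complex \<times> complex) \<Rightarrow>\<^sub>L complex)"
    for x :: complex
  define T2 where "T2 x = blinfun_mult_right x o\<^sub>L (snd_blinfun :: (complex \<times> complex) \<Rightarrow>\<^sub>L complex)"
    for x :: complex
  have bl: "bounded_linear T1" "bounded_linear T2"
    unfolding T1_def T2_def
    by (auto intro!: bounded_linear_intros)
  have quot: "(d * v * n + x * u) / (n * n) = x * u / n\<^sup>2 + d * v / n" if "n \<noteq> 0"
    for d v n x u :: complex
    using that by (simp add: power2_eq_square field_simps)
  \<comment> \<open>\<open>a\<close> and \<open>b\<close> are the two partial derivatives of the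
    integrand of \<open>h\<close>.\<close>
  define a where "a p t = F (c t, snd p) / (c t - fst p)\<^sup>2" for p t
  define b where "b p t = D (c t) (snd p) / (c t - fst p)" for p t
  have deriv_h: "(h has_derivative (\<lambda>(u, v). integral (cbox 0 1) (a p) * u + integral (cbox 0 1) (b p) * v)) (at p)"
    if p: "p \<in> T \<times> T" for p
  proof -
    have "(h has_derivative integral (cbox 0 1) (\<lambda>t. T1 (a p t) + T2 (b p t))) (at p within T \<times> T)"
      unfolding h_def
    proof (rule leibniz_rule)
      fix q t assume q: "q \<in> T \<times> T"
      obtain k where "(F has_derivative (\<lambda>(u, v). k * u + D (c t) (snd q) * v)) (at (c t, snd q))"
        using derivF[OF cS, of "snd q" t] q by auto
      moreover have "((\<lambda>q. (c t, snd q)) has_derivative (\<lambda>u. (0, snd u))) (at q within T \<times> T)"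
        by (auto intro!: derivative_eq_intros)
      ultimately have F': "((\<lambda>q. F (c t, snd q)) has_derivative (\<lambda>u. D (c t) (snd q) * snd u)) (at q within T \<times> T)"
        using has_derivative_compose[of "\<lambda>q. (c t, snd q)" "\<lambda>u. (0, snd u)" q "T \<times> T" F
          "\<lambda>(u, v). k * u + D (c t) (snd q) * v"] by simp
      have ne': "c t - fst q \<noteq> 0" using q ne by auto
      have den: "((\<lambda>q. c t - fst q) has_derivative (\<lambda>u. - fst u)) (at q within T \<times> T)"
        by (auto intro!: derivative_eq_intros)
      show "((\<lambda>q. F (c t, snd q) / (c t - fst q)) has_derivative blinfun_apply (T1 (a q t) + T2 (b q t))) (at q within T \<times> T)"
        by (rule has_derivative_eq_rhs[OF has_derivative_divide'[OF F' den ne']])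
          (simp add: T1_def T2_def a_def b_def plus_blinfun.rep_eq fun_eq_iff quot[OF ne'])
    next
      show "(\<lambda>t. F (c t, snd q) / (c t - fst q)) integrable_on cbox 0 1" if "q \<in> T \<times> T" for q
        using that TS cT cS
        by (intro integrable_continuous continuous_intros) auto
    next
      show "continuous_on ((T \<times> T) \<times> cbox 0 1) (\<lambda>(x, t). T1 (a x t) + T2 (b x t))"
        unfolding case_prod_unfold a_def b_def using TS cT cS
        by (intro continuous_intros bounded_linear.continuous_on[OF bl(1)]
            bounded_linear.continuous_on[OF bl(2)]) auto
    qed (use p in \<open>auto simp: T_def intro!: convex_Times\<close>)
    \<comment> \<open>Integration commutes with the linear maps \<open>T1\<close> and
      \<open>T2\<close>, so the derivative of \<open>h\<close> is again complex linear.\<close>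
    moreover have "integral (cbox 0 1) (\<lambda>t. T1 (a p t) + T2 (b p t))
        = T1 (integral (cbox 0 1) (a p)) + T2 (integral (cbox 0 1) (b p))"
    proof -
      have "a p integrable_on cbox 0 1" "b p integrable_on cbox 0 1"
        unfolding a_def[abs_def] b_def[abs_def] using p TS cT cS
        by (intro integrable_continuous continuous_intros; auto)+
      then have "(a p has_integral integral (cbox 0 1) (a p)) (cbox 0 1)"
        "(b p has_integral integral (cbox 0 1) (b p)) (cbox 0 1)"
        by (auto simp: integrable_integral)
      from has_integral_add[OF has_integral_linear[OF this(1) bl(1)] has_integral_linear[OF this(2) bl(2)]]
      show ?thesis by (intro integral_unique) (simp add: o_def)
    qed
    moreover have "at p within T \<times> T = at p"
      using p by (intro at_within_open) (auto simp: T_def open_Times)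
    ultimately show ?thesis
      by (auto simp: T1_def T2_def case_prod_unfold plus_blinfun.rep_eq elim!: has_derivative_eq_rhs)
  qed
  have T: "open (T \<times> T)" "(0, 0) \<in> T \<times> T"
    using r(1) by (auto simp: T_def open_Times)
  have "holomorphic_near_0 h"
    unfolding holomorphic_near_0_def using deriv_h T by blast
  moreover have "F p = F (0, snd p) + fst p * h p" if pT: "p \<in> T \<times> T" for p
  proof -
    obtain y z where p: "p = (y, z)" "y \<in> T" "z \<in> T"
      using pT by (cases p) auto
    have g: "(\<lambda>y. F (y, z)) holomorphic_on cball 0 r"
      using slice1[of z] p TS by (auto simp: S_def)
    have "((\<lambda>t. F (c t, z) * c t / (c t - y) - F (c t, z) * c t / (c t - 0)) has_integral F (y, z) - F (0, z)) {0..1}"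
      unfolding c_def using p(2) r(1)
      by (intro has_integral_diff Cauchy_integral_real_param(1)[OF g]) (auto simp: T_def)
    moreover have "F (c t, z) * c t / (c t - y) - F (c t, z) * c t / (c t - 0) = y * (F (c t, z) / (c t - y))" for t
      using ne[OF p(2), of t] ne[of 0 t] T by (simp add: field_simps)
    ultimately have "((\<lambda>t. y * (F (c t, z) / (c t - y))) has_integral F (y, z) - F (0, z)) {0..1}"
      by simp
    from integral_unique[OF this] have "y * h p = F (y, z) - F (0, z)"
      unfolding h_def p by (simp del: times_divide_eq_right add: integral_mult_right)
    then show ?thesis by (simp add: p)
  qed
  then have "\<forall>\<^sub>F p in nhds (0, 0). F p = F (0, snd p) + fst p * h p"
    using T by (auto simp: eventually_nhds)
  ultimately show ?thesis using that by blast
qed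

text \<open>Divide first by y, then divide the remaining function of z alone by z.\<close>

lemma holomorphic_near_0_Hadamard:
  assumes F: "holomorphic_near_0 F"
  obtains h k where "holomorphic_near_0 h" "holomorphic_near_0 k"
    "\<forall>\<^sub>F p in nhds (0, 0). F p = F (0, 0) + fst p * h p + snd p * k p"
proof -
  obtain h where h: "holomorphic_near_0 h" "\<forall>\<^sub>F p in nhds (0, 0). F p = F (0, snd p) + fst p * h p"
    by (rule holomorphic_near_0_divide_fst[OF F])
  \<comment> \<open>The restriction to y = 0 is read as a function of the first coordinate, so that
    the same division applies; a swap then brings the quotient back.\<close>
  have "holomorphic_near_0 (\<lambda>p. F (0, fst p))"
    using holomorphic_near_0_compose_linear[OF F, of 0 0 1 0] by simp
  then obtain k where k: "holomorphic_near_0 k"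
      "\<forall>\<^sub>F p in nhds (0, 0). F (0, fst p) = F (0, 0) + fst p * k p"
    by (rule holomorphic_near_0_divide_fst) auto
  have "holomorphic_near_0 (\<lambda>p. k (snd p, fst p))"
    using holomorphic_near_0_compose_linear[OF k(1), of 0 1 1 0] by simp
  moreover have "filterlim (\<lambda>p. (snd p, fst p)) (nhds (0, 0)) (nhds (0::complex, 0::complex))"
  proof -
    have "isCont (\<lambda>p::complex \<times> complex. (snd p, fst p)) (0, 0)"
      by (intro continuous_intros)
    then show ?thesis
      using tendsto_at_iff_tendsto_nhds[of "\<lambda>p. (snd p, fst p)" "(0::complex, 0::complex)"]
      by (simp add: isCont_def)
  qed
  from eventually_compose_filterlim[OF k(2) this]
  have "\<forall>\<^sub>F p in nhds (0, 0). F (0, snd p) = F (0, 0) + snd p * k (snd p, fst p)"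
    by simp
  with h(2) have "\<forall>\<^sub>F p in nhds (0, 0). F p = F (0, 0) + fst p * h p + snd p * k (snd p, fst p)"
    by eventually_elim simp
  ultimately show ?thesis using that h(1) by blast
qed

section \<open>Bounds for the intersection index\<close>

text \<open>The generators may be dependent: each new one either lies in the span already or raises
  the dimension by exactly one.\<close>

lemma (in ring) dim_Span_le:
  assumes K: "subfield K R" and Us: "set Us \<subseteq> carrier R"
  shows "finite_dimension K (Span K Us)" and "dim K (Span K Us) \<le> length Us"
proof -
  show fin: "finite_dimension K (Span K Us)"
    by (rule Span_finite_dimension[OF assms])
  have "\<exists>n\<le>length Us. dimension n K (Span K Us)"
    using Us
  proof (induction Us)
    case Nil
    show ?case by auto
  next
    case (Cons u Us)
    then obtain n where n: "n \<le> length Us" "dimension n K (Span K Us)"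
      by auto
    show ?case
    proof (cases "u \<in> Span K Us")
      case True
      then have "set (u # Us) \<subseteq> Span K Us"
        using Cons.prems Span_base_incl[OF K, of Us] by simp
      with Cons.prems have "Span K (u # Us) = Span K Us"
        by (intro equalityI mono_Span_subset[OF K] mono_Span[OF K]) auto
      with n show ?thesis by (metis le_SucI length_Cons)
    next
      case False
      then have "dimension (Suc n) K (Span K (u # Us))"
        using Suc_dim[of u "Span K Us" n K] n Cons.prems by simp
      with n show ?thesis by (intro exI[of _ "Suc n"]) simp
    qed
  qed
  then show "dim K (Span K Us) \<le> length Us"
    using dimI[OF K] by (auto simp: over_def)
qed

section \<open>Germs: closure rules, constants, and the maximal ideal\<close>

lemma holomorphic_near_0_uminus: "holomorphic_near_0 F \<Longrightarrow> holomorphic_near_0 (\<lambda>p. - F p)"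
  using holomorphic_near_0_mult[OF holomorphic_near_0_const[of "-1"], of F] by simp

lemma holomorphic_near_0_power: "holomorphic_near_0 F \<Longrightarrow> holomorphic_near_0 (\<lambda>p. F p ^ n)"
  by (induction n) (auto intro: holomorphic_near_0_mult holomorphic_near_0_const)

lemmas hol_intros = holomorphic_near_0_const holomorphic_near_0_add holomorphic_near_0_mult
  holomorphic_near_0_uminus holomorphic_near_0_power

lemma germ_hom: "ring_hom_cring hol_ring germ_ring germ"
proof -
  have "(+>\<^bsub>hol_ring\<^esub>) null_germs = germ"
    by (simp add: germ_def fun_eq_iff)
  then show ?thesis
    using ideal.rcos_ring_hom_cring[OF ideal_null_germs cring_hol_ring]
    by (simp add: germ_ring_def)
qed

lemma germ_ring_carrier: "carrier germ_ring = germ ` {F. holomorphic_near_0 F}"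
  by (auto simp: germ_ring_def FactRing_def A_RCOSETS_def' germ_def hol_ring_def)

text \<open>A homomorphism to a nonzero ring carries this field to a subfield; in the local algebra
  its image is the field of scalars.\<close>

lemma subfield_const: "subfield (range (\<lambda>c p. c)) hol_ring"
proof -
  interpret cring hol_ring by (rule cring_hol_ring)
  let ?K = "range (\<lambda>(c::complex) (p::complex\<times>complex). c)"
  have sub: "?K \<subseteq> carrier hol_ring"
    by (auto simp: hol_ring_def holomorphic_near_0_const)
  have inv: "\<ominus>\<^bsub>hol_ring\<^esub> (\<lambda>p. c) = (\<lambda>p. - c)" for c
    by (rule minus_equality) (auto simp: hol_ring_def holomorphic_near_0_const)
  have "subring ?K hol_ring"
    using sub by (rule subringI) (auto simp: inv, auto simp: hol_ring_def)
  then have "subcring ?K hol_ring"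
    by (rule subcringI')
  moreover have "Units (hol_ring\<lparr>carrier := ?K\<rparr>) = ?K - {\<zero>\<^bsub>hol_ring\<^esub>}"
  proof (intro equalityI subsetI)
    fix F assume "F \<in> Units (hol_ring\<lparr>carrier := ?K\<rparr>)"
    then show "F \<in> ?K - {\<zero>\<^bsub>hol_ring\<^esub>}"
      by (auto simp: Units_def hol_ring_def fun_eq_iff)
  next
    fix F assume "F \<in> ?K - {\<zero>\<^bsub>hol_ring\<^esub>}"
    then obtain c where "F = (\<lambda>p. c)" "c \<noteq> 0"
      by (auto simp: hol_ring_def)
    then show "F \<in> Units (hol_ring\<lparr>carrier := ?K\<rparr>)"
      by (auto simp: Units_def hol_ring_def fun_eq_iff intro!: exI[of _ "inverse c"])
  qed
  ultimately show ?thesis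
    by (rule subfieldI)
qed

text \<open>This is the maximal ideal of the local ring. It contains the ideal of any two curves
  through the origin, which therefore is proper.\<close>

lemma ideal_vanishing_germs:
  "ideal (germ ` {F. holomorphic_near_0 F \<and> F (0, 0) = 0}) germ_ring"
proof -
  interpret ring_hom_cring hol_ring germ_ring germ by (rule germ_hom)
  let ?J = "germ ` {F. holomorphic_near_0 F \<and> F (0, 0) = 0}"
  have add: "germ F \<oplus>\<^bsub>germ_ring\<^esub> germ G = germ (\<lambda>p. F p + G p)"
    and mult: "germ F \<otimes>\<^bsub>germ_ring\<^esub> germ G = germ (\<lambda>p. F p * G p)"
    if "holomorphic_near_0 F" "holomorphic_near_0 G" for F G
    using that hom_add[of F G] hom_mult[of F G] by (auto simp: hol_ring_def)
  have zero: "\<zero>\<^bsub>germ_ring\<^esub> = germ (\<lambda>p. 0)"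
    using hom_zero by (simp add: hol_ring_def)
  have inv: "\<ominus>\<^bsub>germ_ring\<^esub> germ F = germ (\<lambda>p. - F p)" if "holomorphic_near_0 F" for F
    using that by (intro S.minus_equality) (simp_all add: add zero germ_ring_carrier hol_intros)
  show ?thesis
  proof (rule idealI)
    show "ring germ_ring" by (rule S.ring_axioms)
    show "subgroup ?J (add_monoid germ_ring)"
    proof (rule S.add.subgroupI)
      show "?J \<subseteq> carrier germ_ring" by (auto simp: germ_ring_carrier)
      show "?J \<noteq> {}" using holomorphic_near_0_const[of 0] by blast
    next
      fix a assume "a \<in> ?J"
      then show "\<ominus>\<^bsub>germ_ring\<^esub> a \<in> ?J"
        by (auto simp: inv intro!: imageI hol_intros)
    next
      fix a b assume "a \<in> ?J" "b \<in> ?J"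
      then show "a \<oplus>\<^bsub>germ_ring\<^esub> b \<in> ?J"
        by (auto simp: add intro!: imageI hol_intros)
    qed
  next
    fix a x assume "a \<in> ?J" "x \<in> carrier germ_ring"
    then show "x \<otimes>\<^bsub>germ_ring\<^esub> a \<in> ?J" "a \<otimes>\<^bsub>germ_ring\<^esub> x \<in> ?J"
      by (auto simp: germ_ring_carrier mult intro!: imageI hol_intros)
  qed
qed

text \<open>By \<open>gen\<close>, \<open>v\<close> generates the maximal ideal modulo (f, g).
  Splitting the remainder factor \<open>k\<close> into its value at the origin and a multiple of
  \<open>v\<close> extends the expansion by one term.\<close>

lemma truncated_expansion:
  assumes f: "holomorphic_near_0 f" and g: "holomorphic_near_0 g"
    and v: "holomorphic_near_0 v"
    and gen: "\<And>h. holomorphic_near_0 h \<Longrightarrow> h (0, 0) = 0 \<Longrightarrow>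
      \<exists>k a b. holomorphic_near_0 k \<and> holomorphic_near_0 a \<and> holomorphic_near_0 b \<and>
        (\<forall>\<^sub>F p in nhds (0, 0). h p = k p * v p + a p * f p + b p * g p)"
    and h: "holomorphic_near_0 h"
  shows "\<exists>c k a b. holomorphic_near_0 k \<and> holomorphic_near_0 a \<and> holomorphic_near_0 b \<and>
    (\<forall>\<^sub>F p in nhds (0, 0).
       h p = (\<Sum>i<n. c i * v p ^ i) + k p * v p ^ n + a p * f p + b p * g p)"
proof (induction n)
  case 0
  show ?case
    using h by (intro exI[of _ "\<lambda>_. 0"] exI[of _ h]) (auto intro: hol_intros)
next
  case (Suc n)
  then obtain c k a b where hol: "holomorphic_near_0 k" "holomorphic_near_0 a" "holomorphic_near_0 b"
    and eq: "\<forall>\<^sub>F p in nhds (0, 0).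
       h p = (\<Sum>i<n. c i * v p ^ i) + k p * v p ^ n + a p * f p + b p * g p"
    by blast
  have "holomorphic_near_0 (\<lambda>p. k p + - k (0, 0))"
    using hol by (intro hol_intros)
  from gen[OF this] obtain k' a' b' where
    hol': "holomorphic_near_0 k'" "holomorphic_near_0 a'" "holomorphic_near_0 b'"
    and eq': "\<forall>\<^sub>F p in nhds (0, 0). k p + - k (0, 0) = k' p * v p + a' p * f p + b' p * g p"
    by auto
  define d where "d = c(n := k (0, 0))"
  have d: "(\<Sum>i<Suc n. d i * v p ^ i) = (\<Sum>i<n. c i * v p ^ i) + k (0, 0) * v p ^ n" for p
    by (simp add: d_def)
  show ?case
  proof (intro exI conjI)
    show "holomorphic_near_0 k'" by (rule hol')
    show "holomorphic_near_0 (\<lambda>p. a p + a' p * v p ^ n)"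
      "holomorphic_near_0 (\<lambda>p. b p + b' p * v p ^ n)"
      using hol hol' v by (auto intro!: hol_intros)
    show "\<forall>\<^sub>F p in nhds (0, 0). h p = (\<Sum>i<Suc n. d i * v p ^ i) + k' p * v p ^ Suc n
        + (a p + a' p * v p ^ n) * f p + (b p + b' p * v p ^ n) * g p"
      using eq eq'
    proof eventually_elim
      case (elim p)
      from elim(2) have k: "k p = k (0, 0) + (k' p * v p + a' p * f p + b' p * g p)"
        by (simp add: algebra_simps)
      show ?case
        unfolding elim(1) d by (subst k) (simp add: algebra_simps)
    qed
  qed
qed

text \<open>Once \<open>v ^ n\<close> lies in (f, g), the remainder of the expansion of length
  \<open>n\<close> disappears and the lower powers of \<open>v\<close> span. The lower bound holds
  because 1 is not in the ideal.\<close>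

lemma intersection_index_bounds:
  assumes f: "holomorphic_near_0 f" "f (0, 0) = 0" and g: "holomorphic_near_0 g" "g (0, 0) = 0"
    and v: "holomorphic_near_0 v"
    and gen: "\<And>h. holomorphic_near_0 h \<Longrightarrow> h (0, 0) = 0 \<Longrightarrow>
      \<exists>k a b. holomorphic_near_0 k \<and> holomorphic_near_0 a \<and> holomorphic_near_0 b \<and>
        (\<forall>\<^sub>F p in nhds (0, 0). h p = k p * v p + a p * f p + b p * g p)"
    and pow: "holomorphic_near_0 a" "holomorphic_near_0 b"
      "\<forall>\<^sub>F p in nhds (0, 0). v p ^ n = a p * f p + b p * g p"
  shows "1 \<le> intersection_index f g" "intersection_index f g \<le> enat n"
proof -
  interpret G: ring_hom_cring hol_ring germ_ring germ by (rule germ_hom)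
  define I where "I = genideal germ_ring {germ f, germ g}"
  define Q where "Q = germ_ring Quot I"
  define \<pi> where "\<pi> = (\<lambda>F. I +>\<^bsub>germ_ring\<^esub> germ F)"
  define K where "K = range (\<lambda>c. \<pi> (\<lambda>p. c))"
  have fg: "{germ f, germ g} \<subseteq> carrier germ_ring"
    using f g by (auto simp: germ_ring_carrier)
  interpret I: ideal I germ_ring
    unfolding I_def using fg by (rule G.S.genideal_ideal)
  interpret Q: cring Q
    unfolding Q_def by (rule I.quotient_is_cring[OF G.S.is_cring])
  have "\<pi> \<in> ring_hom hol_ring Q"
    using ring_hom_trans[OF G.homh I.rcos_ring_hom] by (simp add: Q_def \<pi>_def o_def)
  then interpret P: ring_hom_ring hol_ring Q \<pi>
    by (intro ring_hom_ringI2 G.R.ring_axioms Q.ring_axioms)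
  have add: "\<pi> F \<oplus>\<^bsub>Q\<^esub> \<pi> G = \<pi> (\<lambda>p. F p + G p)" and mult: "\<pi> F \<otimes>\<^bsub>Q\<^esub> \<pi> G = \<pi> (\<lambda>p. F p * G p)"
    if "holomorphic_near_0 F" "holomorphic_near_0 G" for F G
    using that P.hom_add[of F G] P.hom_mult[of F G] by (auto simp: hol_ring_def)
  have zero: "\<zero>\<^bsub>Q\<^esub> = \<pi> (\<lambda>p. 0)" and one: "\<one>\<^bsub>Q\<^esub> = \<pi> (\<lambda>p. 1)"
    using P.hom_zero P.hom_one by (auto simp: hol_ring_def)
  have \<pi>_closed: "\<pi> F \<in> carrier Q" if "holomorphic_near_0 F" for F
    using that P.hom_closed[of F] by (simp add: hol_ring_def)
  have carrier: "carrier Q = \<pi> ` {F. holomorphic_near_0 F}"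
    by (auto simp: Q_def FactRing_def A_RCOSETS_def' \<pi>_def germ_ring_carrier)
  have \<pi>_cong: "\<pi> F = \<pi> G"
    if "holomorphic_near_0 F" "holomorphic_near_0 G" "\<forall>\<^sub>F p in nhds (0, 0). F p = G p" for F G
    using that germ_eq_iff[of F G] by (simp add: \<pi>_def)
  have \<pi>_zero_iff: "\<pi> F = \<zero>\<^bsub>Q\<^esub> \<longleftrightarrow> germ F \<in> I" if "holomorphic_near_0 F" for F
  proof -
    have "germ F \<in> carrier germ_ring" using that by (simp add: germ_ring_carrier)
    then show ?thesis
      unfolding \<pi>_def Q_def FactRing_def
      using I.a_rcos_self I.a_rcos_const by fastforce
  qed
  have \<pi>_fg: "\<pi> f = \<zero>\<^bsub>Q\<^esub>" "\<pi> g = \<zero>\<^bsub>Q\<^esub>"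
    using f g G.S.genideal_self[OF fg] by (simp_all add: \<pi>_zero_iff I_def)
  have \<pi>_ideal: "\<pi> (\<lambda>p. F p + a p * f p + b p * g p) = \<pi> F"
    if "holomorphic_near_0 F" "holomorphic_near_0 a" "holomorphic_near_0 b" for F a b
    using that f g \<pi>_fg
    by (simp add: add[symmetric] mult[symmetric] \<pi>_closed hol_intros)
  \<comment> \<open>Equal germs have equal values at the origin, so 1 cannot be the germ of a
    function vanishing there.\<close>
  have "I \<subseteq> germ ` {F. holomorphic_near_0 F \<and> F (0, 0) = 0}"
    unfolding I_def using f g by (intro G.S.genideal_minimal ideal_vanishing_germs) auto
  moreover have "germ (\<lambda>p. 1) \<noteq> germ F" if "holomorphic_near_0 F" "F (0, 0) = 0" for F
    using that germ_eq_iff[OF holomorphic_near_0_const that(1), of 1]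
    by (auto dest: eventually_nhds_x_imp_x)
  ultimately have one_notin: "germ (\<lambda>p. 1) \<notin> I"
    by auto
  then have nontriv: "\<one>\<^bsub>Q\<^esub> \<noteq> \<zero>\<^bsub>Q\<^esub>"
    using \<pi>_zero_iff[OF holomorphic_near_0_const] by (simp add: one)
  have K: "subfield K Q"
    using P.img_is_subfield(2)[OF subfield_const nontriv] by (simp add: K_def image_image)
  define Us where "Us = map (\<lambda>i. \<pi> (\<lambda>p. v p ^ i)) [0..<n]"
  have Us: "set Us \<subseteq> carrier Q"
    using v by (auto simp: Us_def intro!: \<pi>_closed hol_intros)
  \<comment> \<open>Sums over lists of indices match the list-based linear combinations behind
    \<open>Span\<close>.\<close>
  have comb: "holomorphic_near_0 (\<lambda>p. \<Sum>i\<leftarrow>is. c i * v p ^ i) \<and>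
      Q.combine (map (\<lambda>i. \<pi> (\<lambda>p. c i)) is) (map (\<lambda>i. \<pi> (\<lambda>p. v p ^ i)) is)
      = \<pi> (\<lambda>p. \<Sum>i\<leftarrow>is. c i * v p ^ i)" for c :: "nat \<Rightarrow> complex" and "is"
    using v by (induction "is") (auto simp: zero add mult hol_intros)
  have "carrier Q \<subseteq> Q.Span K Us"
  proof
    fix q assume "q \<in> carrier Q"
    then obtain h where h: "holomorphic_near_0 h" and q: "q = \<pi> h" by (auto simp: carrier)
    from truncated_expansion[OF f(1) g(1) v gen h, of n] obtain c k a' b' where
      hol: "holomorphic_near_0 k" "holomorphic_near_0 a'" "holomorphic_near_0 b'" and
      eq: "\<forall>\<^sub>F p in nhds (0, 0).
         h p = (\<Sum>i<n. c i * v p ^ i) + k p * v p ^ n + a' p * f p + b' p * g p"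
      by blast
    let ?S = "\<lambda>p. \<Sum>i\<leftarrow>[0..<n]. c i * v p ^ i"
    have S: "(\<Sum>i<n. c i * v p ^ i) = ?S p" for p
      by (simp add: interv_sum_list_conv_sum_set_nat atLeast0LessThan)
    note comb = comb[of c "[0..<n]"]
    \<comment> \<open>By \<open>pow\<close>, the remainder \<open>k p * v p ^ n\<close> only adds to
      the multipliers of \<open>f\<close> and \<open>g\<close>.\<close>
    have "q = \<pi> (\<lambda>p. ?S p + (a' p + k p * a p) * f p + (b' p + k p * b p) * g p)"
      unfolding q
    proof (rule \<pi>_cong)
      show "\<forall>\<^sub>F p in nhds (0, 0). h p = ?S p + (a' p + k p * a p) * f p + (b' p + k p * b p) * g p"
        using eq pow(3) by eventually_elim (simp add: S algebra_simps)
    qed (use h comb hol pow f g in \<open>auto intro!: hol_intros\<close>)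
    also have "\<dots> = \<pi> ?S"
      using comb hol pow by (intro \<pi>_ideal) (auto intro!: hol_intros)
    also have "\<dots> = Q.combine (map (\<lambda>i. \<pi> (\<lambda>p. c i)) [0..<n]) Us"
      using comb by (simp add: Us_def)
    finally show "q \<in> Q.Span K Us"
      unfolding Q.Span_mem_iff_length_version[OF K Us]
      by (intro exI[of _ "map (\<lambda>i. \<pi> (\<lambda>p. c i)) [0..<n]"]) (auto simp: K_def Us_def)
  qed
  then have span: "Q.Span K Us = carrier Q"
    using Q.Span_in_carrier[OF _ Us] K by (auto dest: subfieldE(3))
  have fin: "Q.finite_dimension K (carrier Q)" and le: "Q.dim K (carrier Q) \<le> n"
    using Q.dim_Span_le[OF K Us] unfolding span by (simp_all add: Us_def)
  have "Q.dim K (carrier Q) \<noteq> 0"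
  proof
    assume "Q.dim K (carrier Q) = 0"
    then have "Q.dimension 0 K (carrier Q)"
      using Q.finite_dimensionE[OF K fin] by (simp add: over_def)
    then have "carrier Q = {\<zero>\<^bsub>Q\<^esub>}"
      by (rule Q.dimension_zero[OF K])
    then show False
      using nontriv Q.one_closed by simp
  qed
  moreover have "intersection_index f g = enat (Q.dim K (carrier Q))"
    using fin unfolding intersection_index_def Let_def Q_def K_def I_def \<pi>_def by (simp only: if_True)
  ultimately show "1 \<le> intersection_index f g" "intersection_index f g \<le> enat n"
    using le by (auto simp: one_enat_def)
qed

section \<open>Units and polynomial certificates for the bounds\<close>

lemma holomorphic_near_0_inverse:
  assumes F: "holomorphic_near_0 F" and "F (0, 0) \<noteq> 0"
  shows "holomorphic_near_0 (\<lambda>p. inverse (F p))"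
proof -
  obtain U where U: "open U" "(0, 0) \<in> U"
    "\<And>p. p \<in> U \<Longrightarrow> \<exists>a b. (F has_derivative (\<lambda>(u, v). a * u + b * v)) (at p)"
    using F unfolding holomorphic_near_0_def by blast
  have "continuous_on U F"
    using U(3) by (intro continuous_at_imp_continuous_on) (blast dest: has_derivative_continuous)
  then have "open (U \<inter> F -` (- {0}))"
    using U(1) by (intro continuous_open_preimage) auto
  moreover have "\<exists>a b. ((\<lambda>p. inverse (F p)) has_derivative (\<lambda>(u, v). a * u + b * v)) (at p)"
    if p: "p \<in> U \<inter> F -` (- {0})" for p
  proof -
    obtain a b where "(F has_derivative (\<lambda>(u, v). a * u + b * v)) (at p)"
      using U(3) p by blast
    from Deriv.has_derivative_inverse[OF _ this]
    have "((\<lambda>p. inverse (F p)) has_derivative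
        (\<lambda>(u, v). (- (a * (inverse (F p))\<^sup>2)) * u + (- (b * (inverse (F p))\<^sup>2)) * v)) (at p)"
      using p by (simp add: case_prod_unfold algebra_simps power2_eq_square)
    then show ?thesis by blast
  qed
  ultimately show ?thesis
    using U(2) assms(2) unfolding holomorphic_near_0_def by (intro exI) auto
qed

lemma eval2_ring_simps:
  "eval2 0 p = 0" "eval2 1 p = 1" "eval2 (cst c) p = c"
  "eval2 (a + b) p = eval2 a p + eval2 b p" "eval2 (a - b) p = eval2 a p - eval2 b p"
  "eval2 (- a) p = - eval2 a p" "eval2 (a * b) p = eval2 a p * eval2 b p"
  "eval2 (a ^ n) p = eval2 a p ^ n" "eval2 (numeral m) p = numeral m"
  by (simp_all add: eval2_def case_prod_unfold poly_numeral)

text \<open>Both \<open>A\<close> and \<open>U\<close> are units among germs. After division,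
  \<open>lin\<close> puts \<open>w\<close> into (v, f, g), and so every germ vanishing at the
  origin; \<open>pow\<close> puts \<open>v ^ n\<close> into (f, g). Only polynomial identities then
  remain to be checked.\<close>

lemma intersection_index_elimination:
  fixes f g w v A B U :: "complex poly poly"
  assumes wv: "w = Y \<and> v = Z \<or> w = Z \<and> v = Y"
    and f: "eval2 f (0, 0) = 0" and g: "eval2 g (0, 0) = 0"
    and lin: "A * w = B * v + \<alpha> * f + \<beta> * g" and A: "eval2 A (0, 0) \<noteq> 0"
    and pow: "U * v ^ n = \<gamma> * f + \<delta> * g" and U: "eval2 U (0, 0) \<noteq> 0"
  shows "1 \<le> intersection_index (eval2 f) (eval2 g)"
    and "intersection_index (eval2 f) (eval2 g) \<le> enat n"
proof -
  note hol = holomorphic_near_0_eval2 hol_intros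
  have invA: "holomorphic_near_0 (\<lambda>p. inverse (eval2 A p))"
    and invU: "holomorphic_near_0 (\<lambda>p. inverse (eval2 U p))"
    using A U by (auto intro: holomorphic_near_0_inverse holomorphic_near_0_eval2)
  have nonzero: "\<forall>\<^sub>F p in nhds (0, 0). H p \<noteq> 0" if "holomorphic_near_0 H" "H (0, 0) \<noteq> 0" for H
  proof -
    from that obtain a b where "(H has_derivative (\<lambda>(u, v). a * u + b * v)) (at (0, 0))"
      unfolding holomorphic_near_0_def by blast
    then have "isCont H (0, 0)"
      by (rule has_derivative_continuous)
    then have "(H \<longlongrightarrow> H (0, 0)) (nhds (0, 0))"
      by (simp add: isCont_def tendsto_at_iff_tendsto_nhds)
    then show ?thesis
      using that(2) by (rule tendsto_imp_eventually_ne)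
  qed
  note nzA = nonzero[OF holomorphic_near_0_eval2 A] and nzU = nonzero[OF holomorphic_near_0_eval2 U]
  have gen: "\<exists>k a b. holomorphic_near_0 k \<and> holomorphic_near_0 a \<and> holomorphic_near_0 b \<and>
        (\<forall>\<^sub>F p in nhds (0, 0). h p = k p * eval2 v p + a p * eval2 f p + b p * eval2 g p)"
    if h: "holomorphic_near_0 h" "h (0, 0) = 0" for h
  proof -
    obtain h1 h2 where h12: "holomorphic_near_0 h1" "holomorphic_near_0 h2"
      "\<forall>\<^sub>F p in nhds (0, 0). h p = fst p * h1 p + snd p * h2 p"
      using holomorphic_near_0_Hadamard[OF h(1)] h(2) by auto
    obtain k l where kl: "holomorphic_near_0 k" "holomorphic_near_0 l"
      "\<forall>\<^sub>F p in nhds (0, 0). h p = eval2 w p * k p + eval2 v p * l p"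
    proof (cases "w = Y")
      case True
      with wv h12 show ?thesis by (intro that[of h1 h2]) (auto simp: eval2_def case_prod_unfold)
    next
      case False
      with wv h12 show ?thesis by (intro that[of h2 h1]) (auto simp: eval2_def case_prod_unfold add.commute)
    qed
    show ?thesis
    proof (intro exI conjI)
      show "\<forall>\<^sub>F p in nhds (0, 0). h p =
          (l p + k p * (inverse (eval2 A p) * eval2 B p)) * eval2 v p
          + k p * (inverse (eval2 A p) * eval2 \<alpha> p) * eval2 f p
          + k p * (inverse (eval2 A p) * eval2 \<beta> p) * eval2 g p"
        using kl(3) nzA
      proof eventually_elim
        case (elim p)
        have "eval2 A p * eval2 w p = eval2 B p * eval2 v p + eval2 \<alpha> p * eval2 f p + eval2 \<beta> p * eval2 g p"
          using arg_cong[OF lin, of "\<lambda>q. eval2 q p"] by (simp add: eval2_ring_simps)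
        then have "eval2 w p = inverse (eval2 A p) *
            (eval2 B p * eval2 v p + eval2 \<alpha> p * eval2 f p + eval2 \<beta> p * eval2 g p)"
          using elim(2) by (simp add: field_simps)
        then show ?case
          unfolding elim(1) by (simp add: algebra_simps)
      qed
    qed (use kl invA in \<open>auto intro!: hol\<close>)
  qed
  have pow': "\<forall>\<^sub>F p in nhds (0, 0). eval2 v p ^ n =
      inverse (eval2 U p) * eval2 \<gamma> p * eval2 f p + inverse (eval2 U p) * eval2 \<delta> p * eval2 g p"
    using nzU
  proof eventually_elim
    case (elim p)
    have "eval2 U p * eval2 v p ^ n = eval2 \<gamma> p * eval2 f p + eval2 \<delta> p * eval2 g p"
      using arg_cong[OF pow, of "\<lambda>q. eval2 q p"] by (simp add: eval2_ring_simps)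
    then show ?case
      using elim by (simp add: field_simps)
  qed
  note bounds = intersection_index_bounds[OF holomorphic_near_0_eval2 f holomorphic_near_0_eval2 g
      holomorphic_near_0_eval2 gen _ _ pow']
  show "1 \<le> intersection_index (eval2 f) (eval2 g)"
    "intersection_index (eval2 f) (eval2 g) \<le> enat n"
    by (rule bounds; use invU in \<open>auto intro!: hol\<close>)+
qed

section \<open>Pencils with proportional linear parts\<close>

text \<open>
  \<open>lin\<close> eliminates \<open>w\<close> on the curve \<open>f = 0\<close>. In the applications \<open>W\<close> is a power of \<open>A\<close>, up to a
  unit, and \<open>U\<close> and \<open>c\<close> come from replacing \<open>A w\<close> by \<open>- (f + E v)\<close> in \<open>W (g - T f)\<close>.
\<close>

lemma intersection_index_pencil:
  fixes f g w v A E T U W c :: "complex poly poly"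
  assumes "w = Y \<and> v = Z \<or> w = Z \<and> v = Y"
    and "eval2 f (0, 0) = 0" "eval2 g (0, 0) = 0"
    and "n < 7"
    and lin: "A * w + E * v = - f" and "eval2 A (0, 0) \<noteq> 0"
    and pow: "W * (g - T * f) = U * v ^ n + c * f" and "eval2 U (0, 0) \<noteq> 0"
  shows "1 \<le> intersection_index (eval2 f) (eval2 g) \<and> intersection_index (eval2 f) (eval2 g) < 7"
proof -
  have "A * w = (- E) * v + (- 1) * f + 0 * g"
    using lin by (simp add: algebra_simps eq_neg_iff_add_eq_0)
  moreover have "U * v ^ n = (- (W * T) - c) * f + W * g"
    using pow by (simp add: algebra_simps)
  ultimately have "1 \<le> intersection_index (eval2 f) (eval2 g)"
    "intersection_index (eval2 f) (eval2 g) \<le> enat n"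
    using intersection_index_elimination[OF assms(1-3)] assms(6,8) by blast+
  moreover have "enat n < 7"
    using \<open>n < 7\<close> by (simp add: numeral_eq_enat)
  ultimately show ?thesis
    by (auto intro: le_less_trans)
qed

text \<open>Cramer's rule: the determinant, a unit at the origin, times either coordinate lies in
  (f, g). Elimination then applies with exponent 1.\<close>

lemma intersection_index_transversal:
  fixes f g A B C D :: "complex poly poly"
  assumes f: "f = A * Y + B * Z" and g: "g = C * Y + D * Z"
    and det: "eval2 (A * D - B * C) (0, 0) \<noteq> 0"
  shows "1 \<le> intersection_index (eval2 f) (eval2 g) \<and> intersection_index (eval2 f) (eval2 g) < 7"
proof -
  have 0: "eval2 f (0, 0) = 0" "eval2 g (0, 0) = 0"
    unfolding f g eval2_ring_simps by (simp_all add: eval2_def)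
  have "(A * D - B * C) * Y = 0 * Z + D * f + (- B) * g"
    "(A * D - B * C) * Z ^ 1 = (- C) * f + A * g"
    unfolding f g by Groebner_Basis.algebra+
  from intersection_index_elimination[OF _ 0 this(1) det this(2) det]
  show ?thesis
    by (auto simp: one_enat_def numeral_eq_enat intro: le_less_trans)
qed

text \<open>
  The polynomials \<open>Y\<close>, \<open>Z\<close> and the constants enter as variables, because the simplifier would
  otherwise evaluate products of the explicit coefficient lists.
\<close>

lemma pencil_F1:
  fixes f g y z P Q T :: "complex poly poly"
  assumes atoms: "y = Y" "z = Z" "P = cst p" "Q = cst q" "T = cst t"
    and f: "f = - (P * y) - Q * z - y\<^sup>2 - z ^ 3"
    and g: "g = - (T * P * y) - T * Q * z - y\<^sup>2 + y * z\<^sup>2"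
    and pq: "p \<noteq> 0 \<or> q \<noteq> 0" and t: "t \<noteq> 0"
  shows "1 \<le> intersection_index (eval2 f) (eval2 g) \<and> intersection_index (eval2 f) (eval2 g) < 7"
proof -
  have "eval2 y (0, 0) = 0" "eval2 z (0, 0) = 0"
    "eval2 P (0, 0) = p" "eval2 Q (0, 0) = q" "eval2 T (0, 0) = t"
    by (simp_all add: atoms eval2_def)
  note ev = this eval2_ring_simps
  have wv: "y = Y \<and> z = Z \<or> y = Z \<and> z = Y" "z = Y \<and> y = Z \<or> z = Z \<and> y = Y"
    using atoms by blast+
  have 0: "eval2 f (0, 0) = 0" "eval2 g (0, 0) = 0"
    unfolding f g by (simp_all add: ev)
  note elim_y = intersection_index_pencil[OF wv(1) 0] and elim_z = intersection_index_pencil[OF wv(2) 0]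
  \<comment> \<open>Here g - T f = (T - 1) y^2 + z^2 (y + T z); the cases determine its order along
    f = 0.\<close>
  show ?thesis
  proof (cases "q = 0")
    case True
    then have Q: "Q = 0" by (simp add: atoms)
    \<comment> \<open>On the curve y = - z^3 / A, so T z^3 is the leading term: order 3, since
      \<open>t\<close> is nonzero.\<close>
    define A where "A = P + y"
    have lin: "A * y + z\<^sup>2 * z = - f"
      unfolding f Q A_def by Groebner_Basis.algebra
    have pow: "A\<^sup>2 * (g - T * f) = ((T - 1) * z ^ 3 + T * A\<^sup>2 - A * z\<^sup>2) * z ^ 3
        + ((T - 1) * (f + 2 * z ^ 3) - A * z\<^sup>2) * f"
      unfolding f g Q A_def by Groebner_Basis.algebra
    show ?thesis
      by (rule elim_y[OF _ lin _ pow]) (use True pq t in \<open>simp_all add: ev A_def\<close>)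
  next
    case q: False
    define A E where "A = Q + z\<^sup>2" and "E = P + y"
    note A_def = this(1) and E_def = this(2)
    show ?thesis
    proof (cases "t = 1")
      case False
      \<comment> \<open>On the curve z = - E y / A, so (T - 1) y^2 leads: order 2.\<close>
      have lin: "A * z + E * y = - f"
        unfolding f A_def E_def by Groebner_Basis.algebra
      have pow: "A ^ 3 * (g - T * f) = ((T - 1) * A ^ 3 - T * y * E ^ 3 + y * A * E\<^sup>2) * y\<^sup>2
          + (y * A * (f + 2 * E * y) - T * (f\<^sup>2 + 3 * f * E * y + 3 * (E * y)\<^sup>2)) * f"
        unfolding f g A_def E_def by Groebner_Basis.algebra
      show ?thesis
        by (rule elim_z[OF _ lin _ pow]) (use q False in \<open>simp_all add: ev A_def E_def\<close>)
    next
      case True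
      then have T: "T = 1" by (simp add: atoms one_pCons)
      consider "p \<noteq> 0" "p \<noteq> q" | "p = 0" | "p = q" by blast
      then show ?thesis
      proof cases
        case 1
        \<comment> \<open>The tangent direction is z = - (p/q) y, along which neither z nor y + z
          vanishes: order 3.\<close>
        have lin: "A * z + E * y = - f"
          unfolding f T A_def E_def by Groebner_Basis.algebra
        have pow: "A ^ 3 * (g - T * f) = (E\<^sup>2 * (A - E)) * y ^ 3
            + ((f + 2 * E * y) * (A * y - E * y - f) - (E * y)\<^sup>2) * f"
          unfolding f g T A_def E_def by Groebner_Basis.algebra
        show ?thesis
          by (rule elim_z[OF _ lin _ pow]) (use q 1 in \<open>simp_all add: ev A_def E_def\<close>)
      next
        case 2
        then have P: "P = 0" by (simp add: atoms)
        \<comment> \<open>Now \<open>E = y\<close>, so z has order 2 and z^2 (y + z) has order 5,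
          the largest value that occurs.\<close>
        have lin: "A * z + E * y = - f"
          unfolding f T P A_def E_def by Groebner_Basis.algebra
        have pow: "A ^ 3 * (g - T * f) = (A - y) * y ^ 5
            + ((f + 2 * E * y) * (A * y - E * y - f) - (E * y)\<^sup>2) * f"
          unfolding f g T P A_def E_def by Groebner_Basis.algebra
        show ?thesis
          by (rule elim_z[OF _ lin _ pow]) (use q 2 in \<open>simp_all add: ev A_def E_def\<close>)
      next
        case 3
        then have P: "P = Q" by (simp add: atoms)
        \<comment> \<open>Now A - E = z^2 - y, so y + z has order 2 and the total is 4. Replacing
          this further z^2 costs another factor \<open>A\<^sup>2\<close>.\<close>
        have lin: "A * z + E * y = - f"
          unfolding f T P A_def E_def by Groebner_Basis.algebra
        have pow: "A ^ 5 * (g - T * f) = (E\<^sup>2 * (y * E\<^sup>2 - A\<^sup>2)) * y ^ 4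
            + (A\<^sup>2 * ((f + 2 * E * y) * (A * y - E * y - f) - (E * y)\<^sup>2)
            + y ^ 3 * E\<^sup>2 * (f + 2 * E * y)) * f"
          unfolding f g T P A_def E_def by Groebner_Basis.algebra
        show ?thesis
          by (rule elim_z[OF _ lin _ pow]) (use q 3 in \<open>simp_all add: ev A_def E_def\<close>)
      qed
    qed
  qed
qed

text \<open>Here g - T f = (T - 1) (y^2 - y z + z^2) + y z (y + T z). The order is 2 unless T = 1 or
  the tangent line of f divides the quadratic form.\<close>

lemma pencil_F2:
  fixes f g y z P Q T :: "complex poly poly"
  assumes atoms: "y = Y" "z = Z" "P = cst p" "Q = cst q" "T = cst t"
    and f: "f = - (P * y) - Q * z - y\<^sup>2 + y * z - z\<^sup>2 - y * z\<^sup>2"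
    and g: "g = - (T * P * y) - T * Q * z - y\<^sup>2 + y * z - z\<^sup>2 + y\<^sup>2 * z"
    and pq: "p \<noteq> 0 \<or> q \<noteq> 0"
  shows "1 \<le> intersection_index (eval2 f) (eval2 g) \<and> intersection_index (eval2 f) (eval2 g) < 7"
proof -
  have "eval2 y (0, 0) = 0" "eval2 z (0, 0) = 0"
    "eval2 P (0, 0) = p" "eval2 Q (0, 0) = q" "eval2 T (0, 0) = t"
    by (simp_all add: atoms eval2_def)
  note ev = this eval2_ring_simps
  have wv: "y = Y \<and> z = Z \<or> y = Z \<and> z = Y" "z = Y \<and> y = Z \<or> z = Z \<and> y = Y"
    using atoms by blast+
  have 0: "eval2 f (0, 0) = 0" "eval2 g (0, 0) = 0"
    unfolding f g by (simp_all add: ev)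
  note elim_y = intersection_index_pencil[OF wv(1) 0] and elim_z = intersection_index_pencil[OF wv(2) 0]
  show ?thesis
  proof (cases "q = 0")
    case True
    then have Q: "Q = 0" by (simp add: atoms)
    define A where "A = P + y - z + z\<^sup>2"
    show ?thesis
    proof (cases "t = 1")
      case False
      have lin: "A * y + z * z = - f"
        unfolding f Q A_def by Groebner_Basis.algebra
      have pow: "A\<^sup>2 * (g - T * f) = ((T - 1) * (z\<^sup>2 + z * A + A\<^sup>2) + z ^ 3 - T * z\<^sup>2 * A) * z\<^sup>2
          + ((T - 1) * (f + 2 * z\<^sup>2 + z * A) + z * (f + 2 * z\<^sup>2) - T * z\<^sup>2 * A) * f"
        unfolding f g Q A_def by Groebner_Basis.algebra
      show ?thesis
        by (rule elim_y[OF _ lin _ pow]) (use True pq False in \<open>simp_all add: ev A_def\<close>)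
    next
      case t: True
      then have T: "T = 1" by (simp add: atoms one_pCons)
      \<comment> \<open>On the curve y = - z^2 / A, so y z (y + z) has order 4.\<close>
      have lin: "A * y + z * z = - f"
        unfolding f Q T A_def by Groebner_Basis.algebra
      have pow: "A\<^sup>2 * (g - T * f) = (z - A) * z ^ 4
          + (z * (f + 2 * z\<^sup>2) - z\<^sup>2 * A) * f"
        unfolding f g Q T A_def by Groebner_Basis.algebra
      show ?thesis
        by (rule elim_y[OF _ lin _ pow]) (use True pq in \<open>simp_all add: ev A_def\<close>)
    qed
  next
    case q: False
    define A E where "A = Q + z" and "E = P + y - z + z\<^sup>2"
    note A_def = this(1) and E_def = this(2)
    show ?thesis
    proof (cases "t = 1")
      case True
      then have T: "T = 1" by (simp add: atoms one_pCons)
      consider "p \<noteq> 0" "p \<noteq> q" | "p = 0" | "p = q" by blast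
      then show ?thesis
      proof cases
        case 1
        \<comment> \<open>The tangent line is none of y = 0, z = 0, y + z = 0, the factors of g - f:
          order 3.\<close>
        have lin: "A * z + E * y = - f"
          unfolding f T A_def E_def by Groebner_Basis.algebra
        have pow: "A\<^sup>2 * (g - T * f) = (- E * (A - E)) * y ^ 3
            + (y * (2 * E * y + f - A * y)) * f"
          unfolding f g T A_def E_def by Groebner_Basis.algebra
        show ?thesis
          by (rule elim_z[OF _ lin _ pow]) (use q 1 in \<open>simp_all add: ev A_def E_def\<close>)
      next
        case 2
        then have P: "P = 0" by (simp add: atoms)
        \<comment> \<open>With P = 0, \<open>E\<close> vanishes at the origin, so z has order 2.
          Reducing \<open>A * E\<close> modulo f extracts the extra factor y: order 4.\<close>
        have lin: "A * z + E * y = - f"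
          unfolding f T P A_def E_def by Groebner_Basis.algebra
        have pow: "A ^ 3 * (g - T * f) = (- (A - E) * (A + (1 - z) * E)) * y ^ 4
            + (A * y * (2 * E * y + f - A * y) - y ^ 3 * (A - E) * (1 - z)) * f"
          unfolding f g T P A_def E_def by Groebner_Basis.algebra
        show ?thesis
          by (rule elim_z[OF _ lin _ pow]) (use q 2 in \<open>simp_all add: ev A_def E_def\<close>)
      next
        case 3
        then have P: "P = Q" by (simp add: atoms)
        \<comment> \<open>Now A - E = - y + z (2 - z), so y + z has order 2. The unit takes the
          value 3 q^2 at the origin.\<close>
        have lin: "A * z + E * y = - f"
          unfolding f T P A_def E_def by Groebner_Basis.algebra
        have pow: "A ^ 3 * (g - T * f) = (E * (A + (2 - z) * E)) * y ^ 4
            + (A * y * (2 * E * y + f - A * y) + y ^ 3 * E * (2 - z)) * f"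
          unfolding f g T P A_def E_def by Groebner_Basis.algebra
        show ?thesis
          by (rule elim_z[OF _ lin _ pow]) (use q 3 in \<open>simp_all add: ev A_def E_def\<close>)
      qed
    next
      case t: False
      show ?thesis
      proof (cases "p\<^sup>2 + p * q + q\<^sup>2 = 0")
        case False
        then have nz: "q\<^sup>2 + q * p + p\<^sup>2 \<noteq> 0"
          by (simp add: algebra_simps)
        have lin: "A * z + E * y = - f"
          unfolding f A_def E_def by Groebner_Basis.algebra
        have pow: "A\<^sup>2 * (g - T * f) = ((T - 1) * (A\<^sup>2 + A * E + E\<^sup>2) + y * (T * E\<^sup>2 - A * E)) * y\<^sup>2
            + ((T - 1) * (y * A + f + 2 * E * y) - y\<^sup>2 * A + T * y * (f + 2 * E * y)) * f"
          unfolding f g A_def E_def by Groebner_Basis.algebra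
        show ?thesis
          by (rule elim_z[OF _ lin _ pow]) (use q t nz in \<open>simp_all add: ev A_def E_def\<close>)
      next
        case tangent: True
        then have p: "p \<noteq> 0" using q by auto
        have PQ: "P\<^sup>2 + P * Q + Q\<^sup>2 = 0"
          using tangent by (simp add: atoms power2_eq_square)
        \<comment> \<open>The tangent line of \<open>f\<close> divides its quadratic part: by \<open>PQ\<close>,
          \<open>P Q (y^2 - y z + z^2) = (P y + Q z) L\<close>, hence \<open>V (P y + Q z) = - P Q (f + y z^2)\<close>.\<close>
        define L V where "L = Q * y + P * z" and "V = P * Q + L"
        note L_def = this(1) and V_def = this(2)
        show ?thesis
        proof (cases "q = t * p")
          case False
          \<comment> \<open>Modulo f, V (g - T f) is y z times V (y + T z) - (T - 1) L z. Multiplied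
            by \<open>A\<close>, the latter factor equals \<open>y * M + f * k\<close>. At the
            origin \<open>M\<close> is p q (q - t p), so the order is 3.\<close>
          define M k where "M = (T - 1) * L * E + V * (A - T * E)" and "k = (T - 1) * L - T * V"
          note M_def = this(1) and k_def = this(2)
          have lin: "A * z + E * y = - f"
            unfolding f A_def E_def by Groebner_Basis.algebra
          have pow: "(P * Q * V * A\<^sup>2) * (g - T * f) = (- (P * Q * E * M)) * y ^ 3
              + (- ((T - 1) * P * Q * L * A\<^sup>2) - P * Q * y * (y * M + E * y * k + f * k)) * f"
            unfolding f g A_def E_def M_def k_def V_def L_def using PQ by Groebner_Basis.algebra
          show ?thesis
            by (rule elim_z[OF _ lin _ pow]) (use p q False in \<open>simp_all add: ev A_def E_def M_def k_def V_def L_def\<close>)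
        next
          case True
          then have Q: "Q = T * P" by (simp add: atoms)
          \<comment> \<open>Otherwise p^2 + p q + q^2 would be 3 p^2 or p^2. This keeps the new
            \<open>M\<close> below a unit.\<close>
          have qp: "q * q \<noteq> p * p"
          proof
            assume "q * q = p * p"
            then have "q = p \<or> q = - p"
              by (simp add: square_eq_iff)
            then show False
              using tangent p by (auto simp: power2_eq_square)
          qed
          \<comment> \<open>Now P (y + T z) = P y + Q z, so the relation for \<open>V\<close>
            applies again and yields another factor z. Here \<open>y * M + f * k\<close> is
            \<open>A\<close> times (T - 1) L + Q y z, and the order is 4.\<close>
          define M k where "M = (T - 1) * (Q * A - P * E) - Q * (E * y)" and "k = - ((T - 1) * P) - Q * y"
          note M_def = this(1) and k_def = this(2)
          have lin: "A * z + E * y = - f"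
            unfolding f A_def E_def by Groebner_Basis.algebra
          have pow: "(P * Q * V * A ^ 3) * (g - T * f) = (- (P * Q * E\<^sup>2 * M)) * y ^ 4
              + (- (P * Q * (A ^ 3 * ((T - 1) * L + Q * y * z) + y * (E * y)\<^sup>2 * k
              + y * (f + 2 * E * y) * (y * M + f * k)))) * f"
            unfolding f g A_def E_def M_def k_def V_def L_def using PQ Q by Groebner_Basis.algebra
          show ?thesis
            by (rule elim_z[OF _ lin _ pow]) (use p q t qp in \<open>simp_all add: ev A_def E_def M_def k_def V_def L_def\<close>)
        qed
      qed
    qed
  qed
qed

text \<open>Here g - T f = (T - 1) z^2 + y^2 (y + T z).\<close>

lemma pencil_F3:
  fixes f g y z P Q T :: "complex poly poly"
  assumes atoms: "y = Y" "z = Z" "P = cst p" "Q = cst q" "T = cst t"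
    and f: "f = - (P * y) - Q * z - z\<^sup>2 - y\<^sup>2 * z"
    and g: "g = - (T * P * y) - T * Q * z - z\<^sup>2 + y ^ 3"
    and pq: "p \<noteq> 0 \<or> q \<noteq> 0"
  shows "1 \<le> intersection_index (eval2 f) (eval2 g) \<and> intersection_index (eval2 f) (eval2 g) < 7"
proof -
  have "eval2 y (0, 0) = 0" "eval2 z (0, 0) = 0"
    "eval2 P (0, 0) = p" "eval2 Q (0, 0) = q" "eval2 T (0, 0) = t"
    by (simp_all add: atoms eval2_def)
  note ev = this eval2_ring_simps
  have wv: "y = Y \<and> z = Z \<or> y = Z \<and> z = Y" "z = Y \<and> y = Z \<or> z = Z \<and> y = Y"
    using atoms by blast+
  have 0: "eval2 f (0, 0) = 0" "eval2 g (0, 0) = 0"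
    unfolding f g by (simp_all add: ev)
  note elim_y = intersection_index_pencil[OF wv(1) 0] and elim_z = intersection_index_pencil[OF wv(2) 0]
  show ?thesis
  proof (cases "q = 0")
    case True
    then have Q: "Q = 0" by (simp add: atoms)
    define A where "A = P + y * z"
    show ?thesis
    proof (cases "t = 1")
      case False
      have lin: "A * y + z * z = - f"
        unfolding f Q A_def by Groebner_Basis.algebra
      have pow: "A ^ 3 * (g - T * f) = ((T - 1) * A ^ 3 - z ^ 4 + T * z ^ 3 * A) * z\<^sup>2
          + (T * z * A * (f + 2 * z\<^sup>2) - (f\<^sup>2 + 3 * f * z\<^sup>2 + 3 * z ^ 4)) * f"
        unfolding f g Q A_def by Groebner_Basis.algebra
      show ?thesis
        by (rule elim_y[OF _ lin _ pow]) (use True pq False in \<open>simp_all add: ev A_def\<close>)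
    next
      case t: True
      then have T: "T = 1" by (simp add: atoms one_pCons)
      \<comment> \<open>On the curve y = - z^2 / A, so y^2 (y + z) has order 5.\<close>
      have lin: "A * y + z * z = - f"
        unfolding f Q T A_def by Groebner_Basis.algebra
      have pow: "A ^ 3 * (g - T * f) = (A - z) * z ^ 5
          + (T * z * A * (f + 2 * z\<^sup>2) - (f\<^sup>2 + 3 * f * z\<^sup>2 + 3 * z ^ 4)) * f"
        unfolding f g Q T A_def by Groebner_Basis.algebra
      show ?thesis
        by (rule elim_y[OF _ lin _ pow]) (use True pq in \<open>simp_all add: ev A_def\<close>)
    qed
  next
    case q: False
    define A where "A = Q + z + y\<^sup>2"
    consider "p = 0" | "t \<noteq> 1" "p \<noteq> 0" | "t = 1" "p \<noteq> q" | "t = 1" "p = q" by blast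
    then show ?thesis
    proof cases
      case 1
      then have P: "P = 0" by (simp add: atoms)
      \<comment> \<open>Since \<open>A\<close> is a unit, z itself lies in (f), and g - T f reduces
        to y^3 for every \<open>t\<close>.\<close>
      have lin: "A * z + 0 * y = - f"
        unfolding f P A_def by Groebner_Basis.algebra
      have pow: "A\<^sup>2 * (g - T * f) = A\<^sup>2 * y ^ 3
          + ((T - 1) * f - T * A * y\<^sup>2) * f"
        unfolding f g P A_def by Groebner_Basis.algebra
      show ?thesis
        by (rule elim_z[OF _ lin _ pow]) (use q in \<open>simp_all add: ev A_def\<close>)
    next
      case 2
      have lin: "A * z + P * y = - f"
        unfolding f A_def by Groebner_Basis.algebra
      have pow: "A\<^sup>2 * (g - T * f) = ((T - 1) * P\<^sup>2 + A\<^sup>2 * y - T * A * P * y) * y\<^sup>2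
          + ((T - 1) * (f + 2 * P * y) - T * A * y\<^sup>2) * f"
        unfolding f g A_def by Groebner_Basis.algebra
      show ?thesis
        by (rule elim_z[OF _ lin _ pow]) (use q 2 in \<open>simp_all add: ev A_def\<close>)
    next
      case 3
      then have T: "T = 1" by (simp add: atoms one_pCons)
      have lin: "A * z + P * y = - f"
        unfolding f T A_def by Groebner_Basis.algebra
      have pow: "A * (g - T * f) = (A - P) * y ^ 3
          + (- (y\<^sup>2)) * f"
        unfolding f g T A_def by Groebner_Basis.algebra
      show ?thesis
        by (rule elim_z[OF _ lin _ pow]) (use q 3 in \<open>simp_all add: ev A_def\<close>)
    next
      case 4
      then have T: "T = 1" and P: "P = Q" by (simp_all add: atoms one_pCons)
      \<comment> \<open>With P = Q, A - P = z + y^2 vanishes at the origin; one more replacement of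
        z raises the order from 3 to 4.\<close>
      have lin: "A * z + Q * y = - f"
        unfolding f T P A_def by Groebner_Basis.algebra
      have pow: "A\<^sup>2 * (g - T * f) = (A * y - Q) * y ^ 4
          + (- (y ^ 3) - A * y\<^sup>2) * f"
        unfolding f g T P A_def by Groebner_Basis.algebra
      show ?thesis
        by (rule elim_z[OF _ lin _ pow]) (use q 4 in \<open>simp_all add: ev A_def\<close>)
    qed
  qed
qed

section \<open>The three families\<close>

lemma cst_Y_Z_monom: "cst c * Y ^ k * Z ^ l = Polynomial.monom (Polynomial.monom c k) l"
proof -
  have "Y ^ k = [:Polynomial.monom 1 k:]" "Z ^ l = Polynomial.monom 1 l"
    by (simp_all add: poly_const_pow monom_altdef)
  then show ?thesis
    by (simp add: smult_monom)
qed

text \<open>The summands are distinct monomials, so exactly one contributes. This turns the equality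
  of quadratic parts into equations between the coefficients of the families.\<close>

lemma coeff_hom_comp:
  assumes "i \<le> d"
  shows "Polynomial.coeff (Polynomial.coeff (hom_comp d p) (d - i)) i
    = Polynomial.coeff (Polynomial.coeff p (d - i)) i"
proof -
  have "Polynomial.coeff (Polynomial.coeff (hom_comp d p) (d - i)) i
    = (\<Sum>j\<le>d. if j = i then Polynomial.coeff (Polynomial.coeff p (d - i)) i else 0)"
    unfolding hom_comp_def cst_Y_Z_monom coeff_sum using assms
    by (intro sum.cong) (auto simp: coeff_monom coeff_sum)
  then show ?thesis
    using assms by simp
qed

lemma hom_comp_2_eqD:
  assumes "hom_comp 2 g = hom_comp 2 f"
  shows "Polynomial.coeff (Polynomial.coeff g 2) 0 = Polynomial.coeff (Polynomial.coeff f 2) 0"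
    and "Polynomial.coeff (Polynomial.coeff g 1) 1 = Polynomial.coeff (Polynomial.coeff f 1) 1"
    and "Polynomial.coeff (Polynomial.coeff g 0) 2 = Polynomial.coeff (Polynomial.coeff f 0) 2"
  using coeff_hom_comp[of 0 2 f] coeff_hom_comp[of 0 2 g] coeff_hom_comp[of 1 2 f]
    coeff_hom_comp[of 1 2 g] coeff_hom_comp[of 2 2 f] coeff_hom_comp[of 2 2 g] assms
  by simp_all

lemma hom_comp_1_neq_0D:
  assumes "hom_comp 1 f \<noteq> 0"
  shows "Polynomial.coeff (Polynomial.coeff f 0) 1 \<noteq> 0 \<or> Polynomial.coeff (Polynomial.coeff f 1) 0 \<noteq> 0"
  using assms by (auto simp: hom_comp_def)

text \<open>Separates transversal curves from proportional linear parts; \<open>t\<close> is nonzero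
  because the second vector is.\<close>

lemma proportional_or_independent:
  fixes p q r s :: complex
  assumes "p \<noteq> 0 \<or> q \<noteq> 0" "r \<noteq> 0 \<or> s \<noteq> 0"
  obtains "p * s \<noteq> q * r" | t where "t \<noteq> 0" "r = t * p" "s = t * q"
proof (cases "p * s = q * r")
  case True
  show thesis
  proof (cases "p = 0")
    case True
    with assms \<open>p * s = q * r\<close> show thesis
      by (intro that(2)[of "s / q"]) auto
  next
    case False
    with assms \<open>p * s = q * r\<close> show thesis
      by (intro that(2)[of "r / p"]) (auto simp: field_simps)
  qed
qed (rule that(1))

theorem theorem5p7:
  fixes f g :: "complex poly poly"
  assumes "(f, g) \<in> F1 \<union> F2 \<union> F3"
    and "hom_comp 1 f * hom_comp 1 g \<noteq> 0"
    and "hom_comp 2 g = hom_comp 2 f"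
  shows "1 \<le> intersection_index (eval2 f) (eval2 g) \<and>
    intersection_index (eval2 f) (eval2 g) < 7"
proof -
  have "hom_comp 1 f \<noteq> 0" "hom_comp 1 g \<noteq> 0"
    using assms(2) by auto
  note lin = this[THEN hom_comp_1_neq_0D] and quad = hom_comp_2_eqD[OF assms(3)]
  note eval = eval2_ring_simps eval2_simps(2,3)
  from assms(1) consider (F1) C where "f = f1 C" "g = g1 C" | (F2) C where "f = f2 C" "g = g2 C"
    | (F3) C where "f = f3 C" "g = g3 C"
    by (auto simp: F1_def F2_def F3_def)
  then show ?thesis
  proof cases
    case F1
    define p q r s where "p = C 1 0 0 3" "q = C 0 1 0 3" "r = C 1 0 1 2" "s = C 0 1 1 2"
    note pqrs = this
    have nz: "p \<noteq> 0 \<or> q \<noteq> 0" "r \<noteq> 0 \<or> s \<noteq> 0"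
      using lin by (auto simp: F1 f1_def g1_def pqrs numeral_eq_Suc)
    have "C 1 1 1 2 = 0" "C 1 1 0 3 = 0" "C 2 0 1 2 = 1"
      using quad by (auto simp: F1 f1_def g1_def numeral_eq_Suc)
    \<comment> \<open>The common quadratic part is - y^2.\<close>
    then have f: "f = - (cst p * Y) - cst q * Z - Y\<^sup>2 - Z ^ 3"
      and g: "g = - (cst r * Y) - cst s * Z - Y\<^sup>2 + Y * Z\<^sup>2"
      by (simp_all add: F1 f1_def g1_def pqrs one_pCons[symmetric])
    from nz show ?thesis
    proof (cases rule: proportional_or_independent)
      case 1
      \<comment> \<open>At the origin the four cofactors are - p, - q, - r, - s, so the determinant
        there is p s - q r.\<close>
      have "f = (- cst p - Y) * Y + (- cst q - Z\<^sup>2) * Z"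
        and "g = (- cst r - Y + Z\<^sup>2) * Y + (- cst s) * Z"
        unfolding f g by Groebner_Basis.algebra+
      then show ?thesis
        by (rule intersection_index_transversal) (simp only: eval; use 1 in simp)
    next
      case (2 t)
      have "g = - (cst t * cst p * Y) - cst t * cst q * Z - Y\<^sup>2 + Y * Z\<^sup>2"
        unfolding g 2 by simp
      from pencil_F1[OF refl refl refl refl refl f this nz(1) 2(1)] show ?thesis .
    qed
  next
    case F2
    define p q r s where "p = C 1 0 1 2" "q = C 0 1 1 2" "r = C 1 0 2 1" "s = C 0 1 2 1"
    note pqrs = this
    have nz: "p \<noteq> 0 \<or> q \<noteq> 0" "r \<noteq> 0 \<or> s \<noteq> 0"
      using lin by (auto simp: F2 f2_def g2_def pqrs numeral_eq_Suc)
    have "C 2 0 2 1 = 1" "- C 1 1 2 1 = 1" "- C 0 2 2 1 = C 1 1 2 1"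
      using quad by (auto simp: F2 f2_def g2_def numeral_eq_Suc)
    then have "C 2 0 2 1 = 1" "C 1 1 2 1 = - 1" "C 0 2 2 1 = 1"
      by (metis minus_minus)+
    then have "cst (C 2 0 2 1) = 1" "cst (C 1 1 2 1) = - 1" "cst (C 0 2 2 1) = 1"
      by (simp_all add: one_pCons)
    note csts = this
    \<comment> \<open>The common quadratic part is - y^2 + y z - z^2.\<close>
    have f: "f = - (cst p * Y) - cst q * Z - Y\<^sup>2 + Y * Z - Z\<^sup>2 - Y * Z\<^sup>2"
      and g: "g = - (cst r * Y) - cst s * Z - Y\<^sup>2 + Y * Z - Z\<^sup>2 + Y\<^sup>2 * Z"
      unfolding F2 f2_def g2_def pqrs csts by Groebner_Basis.algebra+
    from nz show ?thesis
    proof (cases rule: proportional_or_independent)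
      case 1
      have "f = (- cst p - Y + Z - Z\<^sup>2) * Y + (- cst q - Z) * Z"
        and "g = (- cst r - Y + Z + Y * Z) * Y + (- cst s - Z) * Z"
        unfolding f g by Groebner_Basis.algebra+
      then show ?thesis
        by (rule intersection_index_transversal) (simp only: eval; use 1 in simp)
    next
      case (2 t)
      have "g = - (cst t * cst p * Y) - cst t * cst q * Z - Y\<^sup>2 + Y * Z - Z\<^sup>2 + Y\<^sup>2 * Z"
        unfolding g 2 by simp
      from pencil_F2[OF refl refl refl refl refl f this nz(1)] show ?thesis .
    qed
  next
    case F3
    define p q r s where "p = C 1 0 2 1" "q = C 0 1 2 1" "r = C 1 0 3 0" "s = C 0 1 3 0"
    note pqrs = this
    have nz: "p \<noteq> 0 \<or> q \<noteq> 0" "r \<noteq> 0 \<or> s \<noteq> 0"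
      using lin by (auto simp: F3 f3_def g3_def pqrs numeral_eq_Suc)
    have "C 2 0 3 0 = 0" "C 1 1 3 0 = 0" "C 0 2 3 0 = 1"
      using quad by (auto simp: F3 f3_def g3_def numeral_eq_Suc)
    then have "cst (C 2 0 3 0) = 0" "cst (C 1 1 3 0) = 0" "cst (C 1 1 3 0 - 1) = - 1"
      "cst (C 0 2 3 0) = 1"
      by (simp_all add: one_pCons)
    note csts = this
    \<comment> \<open>The common quadratic part is - z^2.\<close>
    have f: "f = - (cst p * Y) - cst q * Z - Z\<^sup>2 - Y\<^sup>2 * Z"
      and g: "g = - (cst r * Y) - cst s * Z - Z\<^sup>2 + Y ^ 3"
      unfolding F3 f3_def g3_def pqrs csts by Groebner_Basis.algebra+
    from nz show ?thesis
    proof (cases rule: proportional_or_independent)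
      case 1
      have "f = (- cst p - Y * Z) * Y + (- cst q - Z) * Z"
        and "g = (- cst r + Y\<^sup>2) * Y + (- cst s - Z) * Z"
        unfolding f g by Groebner_Basis.algebra+
      then show ?thesis
        by (rule intersection_index_transversal) (simp only: eval; use 1 in simp)
    next
      case (2 t)
      have "g = - (cst t * cst p * Y) - cst t * cst q * Z - Z\<^sup>2 + Y ^ 3"
        unfolding g 2 by simp
      from pencil_F3[OF refl refl refl refl refl f this nz(1)] show ?thesis .
    qed
  qed
qed

end
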